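(* Let $R$ be a Dedekind domain and $\mathfrak{a}$ an ideal of $R$ such that $R/\mathfrak{a}$ is a finite ring. Then $$I_r(R/\mathfrak{a})\geq \mathsf{D}((R/\mathfrak{a})^\times)+\Omega(\mathfrak{a})-\omega(\mathfrak{a}).$$ Moreover, equality holds if $\mathfrak{a}$ is either a power of a prime ideal or a product of distinct prime ideals.
   Context: For a finite commutative ring $T$, $I_r(T)$ is the smallest positive integer $t$ such that every sequence of $t$ (not necessarily distinct) elements of $T$ contains a nonempty subsequence whose elements multiply to an idempotent element of $T$ (an element $x$ with $x^2=x$). For a finite abelian group $G$, $\mathsf{D}(G)$ (Davenport constant) is the smallest positive integer $t$ such that every sequence of $t$ elements of $G$ contains a nonempty subsequence whose elements multiply to the identity; $(R/\mathfrak{a})^\times$ is the unit group of $R/\mathfrak{a}$. For an ideal $\mathfrak{a}$ of a Dedekind domain, $\Omega(\mathfrak{a})$ is the total number of prime ideals in the prime ideal factorization of $\mathfrak{a}$ counted with multiplicity, and $\omega(\mathfrak{a})$ is the number of distinct prime ideals in this factorization. *)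

theory Defs
  imports "HOL-Algebra.Algebra" "HOL-Library.Multiset"
begin

text \<open>
  Dedekind domains are Noetherian integrally closed domains in which every nonzero prime ideal
  is maximal; fields are allowed.  As HOL-Algebra has no fraction fields, integral closedness is
  written with denominators cleared: the equation in \<open>integrally_closed\<close> is the monic equation
  \<open>(a/b)^n + (\<Sum>i<n. c\<^sub>i (a/b)^i) = 0\<close> multiplied by \<open>b^n\<close>, and its conclusion says that
  \<open>a/b\<close> lies in the ring.
\<close>

locale dedekind_domain = noetherian_domain R for R (structure) +
  assumes integrally_closed:
      "\<lbrakk> a \<in> carrier R; b \<in> carrier R; b \<noteq> \<zero>; c \<in> {..<n} \<rightarrow> carrier R;
         a [^] (n::nat) \<oplus> (\<Oplus>i\<in>{..<n}. c i \<otimes> a [^] i \<otimes> b [^] (n - i)) = \<zero> \<rbrakk>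
       \<Longrightarrow> b divides a"
    and nonzero_prime_maximal:
      "\<lbrakk> primeideal P R; P \<noteq> {\<zero>} \<rbrakk> \<Longrightarrow> maximalideal P R"

text \<open>
  A sequence of length \<open>t\<close> is a function on \<open>{..<t}\<close>; a subsequence is given by its index set.
\<close>

definition I_r :: "('a, 'm) monoid_scheme \<Rightarrow> nat" where
  "I_r T = (LEAST t. 0 < t \<and>
     (\<forall>x \<in> {..<t} \<rightarrow> carrier T. \<exists>J \<subseteq> {..<t}. J \<noteq> {} \<and>
        (\<Otimes>\<^bsub>T\<^esub>i\<in>J. x i) \<otimes>\<^bsub>T\<^esub> (\<Otimes>\<^bsub>T\<^esub>i\<in>J. x i) = (\<Otimes>\<^bsub>T\<^esub>i\<in>J. x i)))"

definition davenport :: "('a, 'm) monoid_scheme \<Rightarrow> nat" where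
  "davenport G = (LEAST t. 0 < t \<and>
     (\<forall>x \<in> {..<t} \<rightarrow> carrier G. \<exists>J \<subseteq> {..<t}. J \<noteq> {} \<and> (\<Otimes>\<^bsub>G\<^esub>i\<in>J. x i) = \<one>\<^bsub>G\<^esub>))"

text \<open>
  Products and powers of ideals are taken in the monoid \<open>ideals_set R\<close>; the empty product is the
  unit ideal.  Since all positive powers of the zero ideal coincide, uniqueness of the factorization
  of the zero ideal needs a convention: it is its own factorization, and it does not occur as a
  factor otherwise.
\<close>

definition is_prime_ideal_factorization ::
    "('a, 'm) ring_scheme \<Rightarrow> 'a set \<Rightarrow> 'a set multiset \<Rightarrow> bool" where
  "is_prime_ideal_factorization R A M \<longleftrightarrow>
     (\<forall>P \<in># M. primeideal P R) \<and>
     ({\<zero>\<^bsub>R\<^esub>} \<in># M \<longrightarrow> M = {# {\<zero>\<^bsub>R\<^esub>} #}) \<and>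
     A = (\<Otimes>\<^bsub>ideals_set R\<^esub>P\<in>set_mset M. P [^]\<^bsub>ideals_set R\<^esub> count M P)"

definition prime_ideal_factorization ::
    "('a, 'm) ring_scheme \<Rightarrow> 'a set \<Rightarrow> 'a set multiset" where
  "prime_ideal_factorization R A = (THE M. is_prime_ideal_factorization R A M)"

definition Omega :: "('a, 'm) ring_scheme \<Rightarrow> 'a set \<Rightarrow> nat" where
  "Omega R A = size (prime_ideal_factorization R A)"

definition omega :: "('a, 'm) ring_scheme \<Rightarrow> 'a set \<Rightarrow> nat" where
  "omega R A = card (set_mset (prime_ideal_factorization R A))"

text \<open>In particular the subtraction of \<open>omega\<close> from \<open>Omega\<close> on \<open>nat\<close> does not truncate.\<close>

lemma omega_le_Omega: "omega R A \<le> Omega R A"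
proof -
  have "card (set_mset M) \<le> size M" for M :: "'c multiset"
  proof (induction M)
    case (add x M)
    then show ?case by (simp add: card_insert_if)
  qed simp
  then show ?thesis by (simp add: omega_def Omega_def)
qed

end

theory Submission
  imports Defs
begin

text \<open>
  In a group the only idempotent is the identity, so the Davenport constant of the unit group is its
  own idempotent constant.  For the lower bound, let \<open>A = \<Prod>P\<^sup>e\<close> with distinct maximal ideals \<open>P\<close> and
  extend an extremal sequence of units by \<open>e - 1\<close> copies, for every \<open>P\<close>, of an element \<open>y\<^sub>P\<close> lying in
  \<open>P\<close> but neither in \<open>P\<^sup>2\<close> nor in any other prime divisor of \<open>A\<close>.  If \<open>z\<close> is a product of terms involving
  \<open>y\<^sub>P\<close>, then \<open>z \<in> P\<close> and \<open>z \<notin> P\<^sup>e\<close>, so \<open>z (z - 1) \<notin> P\<^sup>e\<close> and \<open>z\<close> is not idempotent modulo \<open>A\<close>.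

  For \<open>A = P\<^sup>e\<close> the nonunits of \<open>R/A\<close> are the elements of \<open>P/A\<close>, any \<open>e\<close> of which multiply to zero; a
  sequence with fewer than \<open>e\<close> nonunits contains enough units.  For squarefree \<open>A\<close> every element of \<open>R/A\<close> is an
  idempotent times a unit: if \<open>e = a\<^sup>m\<close> is idempotent then \<open>a = e (a + 1 - e)\<close>.
\<close>

section \<open>Idempotent subproducts in finite commutative monoids\<close>

text \<open>The claim that z avoids P^e needs orders at P to add: a product of k elements of P
  outside P^2 and of elements outside P must stay outside P^(k+1). This rests on the invertibility
  of P, and there the Dedekind axioms enter. Everything takes place inside R, so the inverse of P is
  represented by a scalar a and an ideal J with P J = (a), the inverse being J/a; an identity of
  fractional ideals becomes an identity of ideals multiplied by a, and a is cancelled at the end.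
  Integral closedness enters through one fact: b/a maps a nonzero ideal into itself only if a
  divides b. Chinese remainder arguments are replaced by explicit relations r w + p = 1 with p in P
  or in a power of P. The zero ideal equals all its positive powers and so stays outside the
  factorization theory; being prime, it is handled as an intersection of primes, like the squarefree
  ideals.\<close>

lemma (in comm_monoid) UnitsI:
  assumes "a \<in> carrier G" "b \<in> carrier G" "a \<otimes> b = \<one>"
  shows "a \<in> Units G"
proof -
  have "b \<otimes> a = \<one>" using m_comm assms by simp
  then show ?thesis using assms unfolding Units_def by blast
qed

lemma (in comm_monoid) finprod_Units_of:
  assumes "finite J" "x \<in> J \<rightarrow> Units G"
  shows "finprod (units_of G) x J = finprod G x J"
  using assms
proof (induction J)
  case empty
  then show ?case
    by (simp add: comm_monoid.finprod_empty[OF units_comm_group[THEN comm_group.axioms(1)]] units_of_one)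
next
  case (insert j J)
  interpret U: comm_group "units_of G" by (rule units_comm_group)
  have "x \<in> J \<rightarrow> carrier G" "x j \<in> carrier G" using insert.prems by auto
  with insert show ?case
    by (simp add: U.finprod_insert units_of_carrier units_of_mult)
qed

lemma (in group) idempotent_iff_one:
  assumes "z \<in> carrier G"
  shows "z \<otimes> z = z \<longleftrightarrow> z = \<one>"
  using assms l_cancel_one by blast

lemma (in comm_group) davenport_eq_I_r: "davenport G = I_r G"
proof -
  have "(\<Otimes>i\<in>J. x i) \<otimes> (\<Otimes>i\<in>J. x i) = (\<Otimes>i\<in>J. x i) \<longleftrightarrow> (\<Otimes>i\<in>J. x i) = \<one>"
    if "x \<in> {..<t} \<rightarrow> carrier G" "J \<subseteq> {..<t}" for x :: "nat \<Rightarrow> 'a" and t J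
    using that by (intro idempotent_iff_one finprod_closed) auto
  then show ?thesis
    unfolding davenport_def I_r_def
    by (intro arg_cong[where f = Least] ext conj_cong refl ball_cong) (metis (no_types, lifting))
qed

text \<open>Two equal powers make the powers of x eventually periodic; an exponent k in the periodic
  range that is also a multiple of the period satisfies x^k = x^(2k).\<close>

lemma (in monoid) exists_idempotent_power:
  assumes "finite (carrier G)" "x \<in> carrier G"
  shows "\<exists>m>0. x [^] (m::nat) \<otimes> x [^] m = x [^] m"
proof -
  have "range (\<lambda>i::nat. x [^] i) \<subseteq> carrier G" using assms(2) by auto
  then have "\<not> inj (\<lambda>i::nat. x [^] i)"
    using assms(1) finite_subset range_inj_infinite by blast
  then obtain i j :: nat where ij: "i < j" "x [^] i = x [^] j"
    unfolding inj_def by (metis nat_neq_iff)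
  define d where "d = j - i"
  have d: "d > 0" "x [^] i = x [^] (i + d)" using ij by (auto simp: d_def)
  have step: "x [^] k = x [^] (k + d)" if "i \<le> k" for k
  proof -
    have "x [^] k = x [^] i \<otimes> x [^] (k - i)" using that assms(2) by (simp add: nat_pow_mult)
    also have "\<dots> = x [^] (i + d) \<otimes> x [^] (k - i)" using d(2) by simp
    also have "\<dots> = x [^] (k + d)" using that assms(2) by (simp add: nat_pow_mult add.commute)
    finally show ?thesis .
  qed
  have steps: "x [^] k = x [^] (k + l * d)" if "i \<le> k" for k l
  proof (induction l)
    case (Suc l)
    then show ?case using step[of "k + l * d"] that by (simp add: algebra_simps)
  qed simp
  \<comment> \<open>The exponent \<open>Suc i * d\<close> is positive, is at least \<open>i\<close>
    because \<open>d > 0\<close>, and doubling it adds \<open>Suc i\<close> whole periods.\<close>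
  have "i \<le> Suc i * d" using d(1) by (metis Suc_leD mult.commute mult_le_mono1 mult_1 Suc_leI One_nat_def)
  from steps[OF this, of "Suc i"] have "x [^] (Suc i * d) \<otimes> x [^] (Suc i * d) = x [^] (Suc i * d)"
    unfolding nat_pow_mult[OF assms(2)] by (rule sym)
  moreover have "Suc i * d > 0" using d(1) by simp
  ultimately show ?thesis by blast
qed

text \<open>The index type is arbitrary so that a sequence can later be indexed by a disjoint union,
  one summand for units and one for the elements of the primes.\<close>

definition has_idempotent_subproduct :: "('a, 'm) monoid_scheme \<Rightarrow> ('i \<Rightarrow> 'a) \<Rightarrow> 'i set \<Rightarrow> bool"
  where "has_idempotent_subproduct G x K \<longleftrightarrow> (\<exists>J\<subseteq>K. J \<noteq> {} \<and>
     (\<Otimes>\<^bsub>G\<^esub>i\<in>J. x i) \<otimes>\<^bsub>G\<^esub> (\<Otimes>\<^bsub>G\<^esub>i\<in>J. x i) = (\<Otimes>\<^bsub>G\<^esub>i\<in>J. x i))"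

text \<open>\<open>I_r\<close> is a \<open>LEAST\<close>, which carries information only once some
  length is known to work. By pigeonhole a long sequence repeats some a often enough to form an
  idempotent power of a.\<close>

lemma (in comm_monoid) exists_I_r:
  assumes fin: "finite (carrier G)"
  shows "\<exists>t>0. \<forall>x \<in> {..<t} \<rightarrow> carrier G. has_idempotent_subproduct G x {..<t::nat}"
proof -
  obtain m where m: "\<And>a. a \<in> carrier G \<Longrightarrow> m a > (0::nat) \<and> a [^] m a \<otimes> a [^] m a = a [^] m a"
    using exists_idempotent_power[OF fin] by metis
  \<comment> \<open>\<open>N\<close> bounds all exponents \<open>m a\<close> simultaneously, and one
    term more than \<open>card (carrier G) * N\<close> forces some value to occur more than
    \<open>N\<close> times.\<close>
  define N where "N = (\<Sum>a\<in>carrier G. m a)"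
  define t where "t = Suc (card (carrier G) * N)"
  have "has_idempotent_subproduct G x {..<t}" if x: "x \<in> {..<t} \<rightarrow> carrier G" for x
  proof -
    have "\<exists>a\<in>carrier G. card (x -` {a} \<inter> {..<t}) * card (carrier G) \<ge> card {..<t}"
      using x fin by (intro pigeonhole_card) auto
    then obtain a where a: "a \<in> carrier G"
      and "card (x -` {a} \<inter> {..<t}) * card (carrier G) > N * card (carrier G)"
      by (auto simp: t_def mult.commute Suc_le_eq)
    then have "N < card (x -` {a} \<inter> {..<t})" by simp
    note a = a this
    have "m a \<le> N" unfolding N_def using fin a(1) by (intro member_le_sum) auto
    then obtain J where J: "J \<subseteq> x -` {a} \<inter> {..<t}" "card J = m a"
      using a(2) by (metis obtain_subset_with_card_n less_imp_le order_trans)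
    have "(\<Otimes>i\<in>J. x i) = (\<Otimes>i\<in>J. a)"
      using J(1) a(1) by (intro finprod_cong') auto
    also have "\<dots> = a [^] m a" using J(2) a(1) by (simp add: finprod_const)
    finally have "(\<Otimes>i\<in>J. x i) = a [^] m a" .
    moreover have "J \<noteq> {}" using J(2) m[OF a(1)] by auto
    ultimately show ?thesis
      unfolding has_idempotent_subproduct_def using J(1) m[OF a(1)] by (intro exI[of _ J]) auto
  qed
  then show ?thesis by (intro exI[of _ t]) (auto simp: t_def)
qed

lemma I_r_eq_Least:
  "I_r G = (LEAST t. 0 < t \<and> (\<forall>x \<in> {..<t} \<rightarrow> carrier G. has_idempotent_subproduct G x {..<t}))"
  unfolding I_r_def has_idempotent_subproduct_def ..

lemma I_r_le:
  assumes "t > 0" "\<And>x. x \<in> {..<t} \<rightarrow> carrier G \<Longrightarrow> has_idempotent_subproduct G x {..<t::nat}"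
  shows "I_r G \<le> t"
  unfolding I_r_eq_Least using assms by (intro Least_le) auto

lemma (in comm_monoid) I_r_pos: "finite (carrier G) \<Longrightarrow> I_r G > 0"
  unfolding I_r_eq_Least using LeastI_ex[OF exists_I_r] by blast

text \<open>This frees the constant from initial segments of the naturals: \<open>I_r G\<close>
  indices are selected from \<open>K\<close> and enumerated by a bijection.\<close>

lemma (in comm_monoid) has_idempotent_subproduct_I_r:
  assumes "finite (carrier G)" "finite K" "x \<in> K \<rightarrow> carrier G" "I_r G \<le> card K"
  shows "has_idempotent_subproduct G x K"
proof -
  have I: "\<forall>x \<in> {..<I_r G} \<rightarrow> carrier G. has_idempotent_subproduct G x {..<I_r G}"
    unfolding I_r_eq_Least using LeastI_ex[OF exists_I_r[OF assms(1)]] by blast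
  obtain K' where K': "K' \<subseteq> K" "card K' = I_r G" "finite K'"
    using assms(2,4) by (metis obtain_subset_with_card_n)
  then obtain h where h: "bij_betw h {..<I_r G} K'"
    by (metis atLeast0LessThan ex_bij_betw_nat_finite)
  then have hK: "h ` {..<I_r G} \<subseteq> K" and inj: "inj_on h {..<I_r G}"
    using K'(1) by (auto simp: bij_betw_def)
  then have "x \<circ> h \<in> {..<I_r G} \<rightarrow> carrier G" using assms(3) by (force simp: Pi_iff)
  with I have "has_idempotent_subproduct G (x \<circ> h) {..<I_r G}" by (rule bspec)
  then obtain J where J: "J \<subseteq> {..<I_r G}" "J \<noteq> {}"
    "(\<Otimes>i\<in>J. (x \<circ> h) i) \<otimes> (\<Otimes>i\<in>J. (x \<circ> h) i) = (\<Otimes>i\<in>J. (x \<circ> h) i)"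
    unfolding has_idempotent_subproduct_def by blast
  have "(\<Otimes>i\<in>h ` J. x i) = (\<Otimes>i\<in>J. x (h i))"
    using hK J(1) assms(3) inj by (intro finprod_reindex) (auto intro: inj_on_subset)
  then have "(\<Otimes>i\<in>h ` J. x i) \<otimes> (\<Otimes>i\<in>h ` J. x i) = (\<Otimes>i\<in>h ` J. x i)"
    using J(3) by (simp only: comp_def)
  moreover have "h ` J \<subseteq> K" "h ` J \<noteq> {}" using J(1,2) hK by auto
  ultimately show ?thesis unfolding has_idempotent_subproduct_def by blast
qed

lemma (in comm_monoid) exists_no_idempotent_subproduct:
  assumes "t < I_r G"
  shows "\<exists>x \<in> {..<t} \<rightarrow> carrier G. \<not> has_idempotent_subproduct G x {..<t}"
proof (cases "t = 0")
  \<comment> \<open>Minimality says nothing at length 0, which the \<open>LEAST\<close> excludes;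
    there the empty index set has no nonempty subset.\<close>
  case True
  then show ?thesis by (auto simp: has_idempotent_subproduct_def)
next
  case False
  then show ?thesis using not_less_Least[OF assms[unfolded I_r_eq_Least]] by blast
qed

lemma (in comm_monoid) has_idempotent_subproduct_units_of:
  assumes "finite K" "x \<in> K \<rightarrow> Units G"
  shows "has_idempotent_subproduct (units_of G) x K \<longleftrightarrow> has_idempotent_subproduct G x K"
proof -
  have "finprod (units_of G) x J = finprod G x J" if "J \<subseteq> K" for J
    using that assms finite_subset by (intro finprod_Units_of) auto
  then show ?thesis unfolding has_idempotent_subproduct_def
    by (metis (no_types, lifting) units_of_mult)
qed

lemma (in comm_monoid) I_r_units_of_le:
  assumes fin: "finite (carrier G)"
  shows "I_r (units_of G) \<le> I_r G"
proof (rule ccontr)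
  interpret U: comm_group "units_of G" by (rule units_comm_group)
  assume "\<not> I_r (units_of G) \<le> I_r G"
  then obtain x where x: "x \<in> {..<I_r G} \<rightarrow> carrier (units_of G)"
    "\<not> has_idempotent_subproduct (units_of G) x {..<I_r G}"
    using U.exists_no_idempotent_subproduct by (metis not_le)
  from x(1) have x': "x \<in> {..<I_r G} \<rightarrow> Units G" "x \<in> {..<I_r G} \<rightarrow> carrier G"
    by (auto simp: units_of_carrier)
  then show False
    using has_idempotent_subproduct_I_r[OF fin _ x'(2)] x(2)
      has_idempotent_subproduct_units_of[OF _ x'(1)] by simp
qed

lemma (in comm_monoid) has_idempotent_subproduct_units:
  assumes fin: "finite (carrier G)" and "finite K" "x \<in> K \<rightarrow> Units G" "I_r (units_of G) \<le> card K"
  shows "\<exists>J\<subseteq>K. J \<noteq> {} \<and> (\<Otimes>i\<in>J. x i) = \<one>"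
proof -
  interpret U: comm_group "units_of G" by (rule units_comm_group)
  have x: "x \<in> K \<rightarrow> carrier (units_of G)" using assms(3) by (simp add: units_of_carrier)
  have "finite (carrier (units_of G))"
    using fin finite_subset[of "Units G" "carrier G"] by (auto simp: units_of_carrier)
  then obtain J where J: "J \<subseteq> K" "J \<noteq> {}" "finprod (units_of G) x J \<otimes>\<^bsub>units_of G\<^esub> finprod (units_of G) x J
      = finprod (units_of G) x J"
    using U.has_idempotent_subproduct_I_r[OF _ assms(2) x assms(4)]
    unfolding has_idempotent_subproduct_def by blast
  then have "finprod (units_of G) x J = \<one>"
    using x U.idempotent_iff_one[OF U.finprod_closed, of x J] by (auto simp: units_of_one)
  then show ?thesis
    using J(1,2) finprod_Units_of[of J x] assms(2,3) finite_subset by (metis Pi_anti_mono subsetD)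
qed

text \<open>If \<open>x\<^sub>i = e\<^sub>i u\<^sub>i\<close> with \<open>e\<^sub>i\<close> idempotent and \<open>u\<^sub>i\<close> a unit, then the product of any \<open>x\<^sub>i\<close> for which
  the \<open>u\<^sub>i\<close> multiply to one is the product of the \<open>e\<^sub>i\<close>.\<close>

lemma (in comm_monoid) I_r_eq_units_of:
  assumes fin: "finite (carrier G)"
    and dec: "\<And>a. a \<in> carrier G \<Longrightarrow> \<exists>e\<in>carrier G. \<exists>u\<in>Units G. e \<otimes> e = e \<and> a = e \<otimes> u"
  shows "I_r G = I_r (units_of G)"
proof (rule antisym)
  interpret U: comm_group "units_of G" by (rule units_comm_group)
  let ?t = "I_r (units_of G)"
  have finU: "finite (carrier (units_of G))"
    using fin finite_subset[of "Units G" "carrier G"] by (auto simp: units_of_carrier)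
  obtain e u where eu: "\<And>a. a \<in> carrier G \<Longrightarrow> e a \<in> carrier G \<and> u a \<in> Units G \<and> e a \<otimes> e a = e a \<and> a = e a \<otimes> u a"
    using dec by metis
  show "I_r G \<le> ?t"
  proof (rule I_r_le[OF U.I_r_pos[OF finU]])
    fix x assume x: "x \<in> {..<?t} \<rightarrow> carrier G"
    have xi: "x i \<in> carrier G" if "i < ?t" for i using x that by auto
    have ex: "e (x i) \<in> carrier G" and ux: "u (x i) \<in> Units G" if "i < ?t" for i
      using eu[OF xi[OF that]] by blast+
    have "\<exists>J\<subseteq>{..<?t}. J \<noteq> {} \<and> (\<Otimes>i\<in>J. u (x i)) = \<one>"
      using ux by (intro has_idempotent_subproduct_units[OF fin]) auto
    then obtain J where J: "J \<subseteq> {..<?t}" "J \<noteq> {}" "(\<Otimes>i\<in>J. u (x i)) = \<one>" by blast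
    have E: "(\<lambda>i. e (x i)) \<in> J \<rightarrow> carrier G" and V: "(\<lambda>i. u (x i)) \<in> J \<rightarrow> carrier G"
      using J(1) ex ux Units_closed by (auto simp: Pi_iff subset_iff)
    have "(\<Otimes>i\<in>J. x i) = (\<Otimes>i\<in>J. e (x i) \<otimes> u (x i))"
    proof (rule finprod_cong')
      show "(\<lambda>i. e (x i) \<otimes> u (x i)) \<in> J \<rightarrow> carrier G" using E V by fast
      show "x i = e (x i) \<otimes> u (x i)" if "i \<in> J" for i using eu xi that J(1) by blast
    qed simp
    also have "\<dots> = (\<Otimes>i\<in>J. e (x i))"
      using finprod_multf[OF E V] J(3) E by simp
    finally have P: "(\<Otimes>i\<in>J. x i) = (\<Otimes>i\<in>J. e (x i))" .
    have "(\<Otimes>i\<in>J. e (x i)) \<otimes> (\<Otimes>i\<in>J. e (x i)) = (\<Otimes>i\<in>J. e (x i) \<otimes> e (x i))"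
      using finprod_multf[OF E E] by simp
    also have "\<dots> = (\<Otimes>i\<in>J. e (x i))"
    proof (rule finprod_cong')
      show "e (x i) \<otimes> e (x i) = e (x i)" if "i \<in> J" for i using eu xi that J(1) by blast
    qed (use E in simp_all)
    finally show "has_idempotent_subproduct G x {..<?t}"
      unfolding has_idempotent_subproduct_def using J(1,2) P by metis
  qed
qed (rule I_r_units_of_le[OF fin])

text \<open>With D the constant of the unit group, D + n - 1 terms contain either n nonunits, giving
  the idempotent 0, or D units, giving the idempotent 1.\<close>

lemma (in cring) I_r_le_of_nilpotent_nonunits:
  assumes fin: "finite (carrier R)" and "n > 0"
    and nil: "\<And>(J::nat set) x. finite J \<Longrightarrow> card J = n \<Longrightarrow> x \<in> J \<rightarrow> carrier R - Units R \<Longrightarrow> (\<Otimes>i\<in>J. x i) = \<zero>"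
  shows "I_r R \<le> I_r (units_of R) + n - 1"
proof (rule I_r_le)
  interpret U: comm_group "units_of R" by (rule units_comm_group)
  let ?D = "I_r (units_of R)"
  let ?t = "?D + n - 1"
  have "finite (carrier (units_of R))"
    using fin finite_subset[of "Units R" "carrier R"] by (auto simp: units_of_carrier)
  then have "?D > 0" by (rule U.I_r_pos)
  then show "?t > 0" using \<open>n > 0\<close> by simp
  fix x assume x: "x \<in> {..<?t} \<rightarrow> carrier R"
  define N where "N = {i. i < ?t \<and> x i \<notin> Units R}"
  have N: "finite N" "N \<subseteq> {..<?t}" by (auto simp: N_def)
  show "has_idempotent_subproduct R x {..<?t}"
  proof (cases "n \<le> card N")
    case True
    then obtain J where J: "J \<subseteq> N" "card J = n" "finite J"
      by (metis obtain_subset_with_card_n)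
    have "x \<in> J \<rightarrow> carrier R - Units R" using J(1) x by (auto simp: N_def)
    then have "(\<Otimes>i\<in>J. x i) = \<zero>" using nil J by blast
    moreover have "J \<noteq> {}" using J \<open>n > 0\<close> by auto
    ultimately show ?thesis unfolding has_idempotent_subproduct_def using J(1) N(2)
      by (intro exI[of _ J]) auto
  next
    case False
    have "card ({..<?t} - N) = ?t - card N" using N by (simp add: card_Diff_subset)
    then have "?D \<le> card ({..<?t} - N)" using False by simp
    then obtain J where "J \<subseteq> {..<?t} - N" "J \<noteq> {}" "(\<Otimes>i\<in>J. x i) = \<one>"
      using has_idempotent_subproduct_units[OF fin, of "{..<?t} - N" x] by (auto simp: N_def)
    then show ?thesis unfolding has_idempotent_subproduct_def
      by (intro exI[of _ J]) auto
  qed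
qed

section \<open>Powers and products of ideals\<close>

lemma ideal_prod_subsetI:
  assumes "ideal K R" "\<And>i j. i \<in> I \<Longrightarrow> j \<in> J \<Longrightarrow> i \<otimes>\<^bsub>R\<^esub> j \<in> K"
  shows "I \<cdot>\<^bsub>R\<^esub> J \<subseteq> K"
proof
  fix z assume "z \<in> I \<cdot>\<^bsub>R\<^esub> J"
  then show "z \<in> K"
    by induction (use assms additive_subgroup.a_closed[OF ideal.axioms(1)[OF assms(1)]] in auto)
qed

lemma ideal_prod_mono:
  assumes "I \<subseteq> I'" "J \<subseteq> J'"
  shows "I \<cdot>\<^bsub>R\<^esub> J \<subseteq> I' \<cdot>\<^bsub>R\<^esub> J'"
proof
  fix z assume "z \<in> I \<cdot>\<^bsub>R\<^esub> J"
  then show "z \<in> I' \<cdot>\<^bsub>R\<^esub> J'"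
    by induction (use assms in \<open>blast intro: ideal_prod.intros\<close>)+
qed

abbreviation ideal_pow :: "('a, 'm) ring_scheme \<Rightarrow> 'a set \<Rightarrow> nat \<Rightarrow> 'a set"
  where "ideal_pow R P n \<equiv> P [^]\<^bsub>ideals_set R\<^esub> n"

text \<open>The product has literally the shape used in \<open>is_prime_ideal_factorization\<close>;
  the recursion needed for multiset induction is derived in
  \<open>ideal_mset_prod_add\<close>.\<close>

definition ideal_mset_prod :: "('a, 'm) ring_scheme \<Rightarrow> 'a set multiset \<Rightarrow> 'a set"
  where "ideal_mset_prod R M = (\<Otimes>\<^bsub>ideals_set R\<^esub>P\<in>set_mset M. ideal_pow R P (count M P))"

lemma ideals_set_simps [simp]:
  "carrier (ideals_set R) = {I. ideal I R}"
  "I \<otimes>\<^bsub>ideals_set R\<^esub> J = I \<cdot>\<^bsub>R\<^esub> J"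
  "one (ideals_set R) = carrier R"
  by (simp_all add: ideals_set_def)

context cring
begin

lemma ideal_pow_0: "ideal_pow R P 0 = carrier R"
  by (simp add: nat_pow_def)

lemma ideal_pow_Suc: "ideal_pow R P (Suc n) = ideal_pow R P n \<cdot> P"
  by (simp add: nat_pow_def)

lemma ideal_ideal_pow:
  assumes "ideal P R"
  shows "ideal (ideal_pow R P n) R"
  by (induction n) (simp_all add: ideal_pow_0 ideal_pow_Suc oneideal ideal_prod_is_ideal assms)

lemma ideal_one_prod: "ideal I R \<Longrightarrow> carrier R \<cdot> I = I"
  using ideal_prod_commute[OF oneideal] ideal_prod_one by simp

lemma ideal_pow_1: "ideal P R \<Longrightarrow> ideal_pow R P (Suc 0) = P"
  by (simp add: ideal_pow_Suc ideal_pow_0 ideal_prod_one ideal_prod_commute oneideal)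

lemma ideal_pow_antimono:
  assumes "ideal P R" "m \<le> n"
  shows "ideal_pow R P n \<subseteq> ideal_pow R P m"
  using assms(2)
proof (induction rule: dec_induct)
  case (step n)
  then show ?case
    using ideal_prod_inter[OF ideal_ideal_pow[OF assms(1)] assms(1)] by (auto simp: ideal_pow_Suc)
qed simp

text \<open>The power of \<open>P\<close> is separated even when its exponent is 0, so that adding
  one more \<open>P\<close> changes a single factor whether or not \<open>P\<close> already
  occurs.\<close>

lemma ideal_mset_prod_split:
  assumes "\<And>Q. Q \<in># M \<Longrightarrow> ideal Q R" "ideal P R"
  shows "ideal_mset_prod R M = ideal_pow R P (count M P) \<cdot>
    (\<Otimes>\<^bsub>ideals_set R\<^esub>Q\<in>set_mset M - {P}. ideal_pow R Q (count M Q))"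
proof -
  interpret ideals: comm_monoid "ideals_set R" by (rule ideals_set_is_comm_monoid)
  have cl: "(\<lambda>Q. ideal_pow R Q (count M Q)) \<in> set_mset M - {P} \<rightarrow> carrier (ideals_set R)"
    using assms(1) by (auto simp: ideal_ideal_pow)
  show ?thesis
  proof (cases "P \<in># M")
    case True
    then have "set_mset M = insert P (set_mset M - {P})" by auto
    then have "ideal_mset_prod R M = (\<Otimes>\<^bsub>ideals_set R\<^esub>Q\<in>insert P (set_mset M - {P}). ideal_pow R Q (count M Q))"
      by (simp add: ideal_mset_prod_def)
    also have "\<dots> = ideal_pow R P (count M P) \<otimes>\<^bsub>ideals_set R\<^esub>
        (\<Otimes>\<^bsub>ideals_set R\<^esub>Q\<in>set_mset M - {P}. ideal_pow R Q (count M Q))"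
      using cl assms(2) by (intro ideals.finprod_insert) (auto simp: ideal_ideal_pow)
    finally show ?thesis by simp
  next
    case False
    have "ideal (\<Otimes>\<^bsub>ideals_set R\<^esub>Q\<in>set_mset M - {P}. ideal_pow R Q (count M Q)) R"
      using ideals.finprod_closed[OF cl] by simp
    moreover have "set_mset M - {P} = set_mset M" "count M P = 0"
      using False by (auto simp: not_in_iff)
    ultimately show ?thesis
      using assms(2) by (simp add: ideal_mset_prod_def ideal_one_prod)
  qed
qed

lemma ideal_mset_prod_empty: "ideal_mset_prod R {#} = carrier R"
  using comm_monoid.finprod_empty[OF ideals_set_is_comm_monoid]
  by (simp add: ideal_mset_prod_def)

lemma ideal_ideal_mset_prod:
  assumes "\<And>Q. Q \<in># M \<Longrightarrow> ideal Q R"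
  shows "ideal (ideal_mset_prod R M) R"
  using comm_monoid.finprod_closed[OF ideals_set_is_comm_monoid, of _ "set_mset M"] assms
  unfolding ideal_mset_prod_def by (force simp: ideal_ideal_pow)

lemma ideal_mset_prod_add:
  assumes "\<And>Q. Q \<in># M \<Longrightarrow> ideal Q R" "ideal P R"
  shows "ideal_mset_prod R (add_mset P M) = P \<cdot> ideal_mset_prod R M"
proof -
  interpret ideals: comm_monoid "ideals_set R" by (rule ideals_set_is_comm_monoid)
  define B where "B = (\<Otimes>\<^bsub>ideals_set R\<^esub>Q\<in>set_mset M - {P}. ideal_pow R Q (count M Q))"
  have cl: "(\<lambda>Q. ideal_pow R Q (count M Q)) \<in> set_mset M - {P} \<rightarrow> carrier (ideals_set R)"
    using assms(1) by (auto simp: ideal_ideal_pow)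
  then have B: "ideal B R"
    using ideals.finprod_closed[OF cl] by (simp add: B_def)
  have "(\<Otimes>\<^bsub>ideals_set R\<^esub>Q\<in>set_mset (add_mset P M) - {P}. ideal_pow R Q (count (add_mset P M) Q)) = B"
    unfolding B_def using cl by (intro ideals.finprod_cong') auto
  then have "ideal_mset_prod R (add_mset P M) = ideal_pow R P (Suc (count M P)) \<cdot> B"
    using ideal_mset_prod_split[of "add_mset P M" P] assms by auto
  also have "\<dots> = P \<cdot> (ideal_pow R P (count M P) \<cdot> B)"
    using assms(2) B ideal_ideal_pow[OF assms(2), of "count M P"]
    unfolding ideal_pow_Suc by (metis ideal_prod_assoc ideal_prod_commute)
  also have "ideal_pow R P (count M P) \<cdot> B = ideal_mset_prod R M"
    unfolding B_def using ideal_mset_prod_split[OF assms] by simp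
  finally show ?thesis .
qed

lemma ideal_mset_prod_subset_pow:
  assumes "\<And>Q. Q \<in># M \<Longrightarrow> ideal Q R" "P \<in># M"
  shows "ideal_mset_prod R M \<subseteq> ideal_pow R P (count M P)"
proof -
  interpret ideals: comm_monoid "ideals_set R" by (rule ideals_set_is_comm_monoid)
  have P: "ideal P R" using assms by blast
  have "(\<lambda>Q. ideal_pow R Q (count M Q)) \<in> set_mset M - {P} \<rightarrow> carrier (ideals_set R)"
    using assms(1) by (auto simp: ideal_ideal_pow)
  from ideals.finprod_closed[OF this]
  have "ideal (\<Otimes>\<^bsub>ideals_set R\<^esub>Q\<in>set_mset M - {P}. ideal_pow R Q (count M Q)) R"
    by simp
  from ideal_prod_inter[OF ideal_ideal_pow[OF P] this] show ?thesis
    using ideal_mset_prod_split[of M P] assms(1) P by auto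
qed

lemma ideal_mset_prod_subset:
  assumes "\<And>Q. Q \<in># M \<Longrightarrow> ideal Q R" "P \<in># M"
  shows "ideal_mset_prod R M \<subseteq> P"
proof -
  have "ideal P R" using assms by blast
  moreover have "Suc 0 \<le> count M P" using assms(2) by (simp add: Suc_le_eq)
  ultimately show ?thesis
    using ideal_mset_prod_subset_pow[OF assms] ideal_pow_antimono[of P "Suc 0" "count M P"] ideal_pow_1[of P]
    by blast
qed

lemma ideal_mset_prod_union:
  assumes "\<And>Q. Q \<in># M \<Longrightarrow> ideal Q R" "\<And>Q. Q \<in># N \<Longrightarrow> ideal Q R"
  shows "ideal_mset_prod R (M + N) = ideal_mset_prod R M \<cdot> ideal_mset_prod R N"
  using assms(1)
proof (induction M)
  case empty
  have "ideal (ideal_mset_prod R N) R" using assms(2) by (rule ideal_ideal_mset_prod)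
  then show ?case
    by (simp add: ideal_mset_prod_empty ideal_one_prod)
next
  case (add P M)
  have P: "ideal P R" and M: "\<And>Q. Q \<in># M \<Longrightarrow> ideal Q R" using add.prems by auto
  have "ideal_mset_prod R (add_mset P (M + N)) = P \<cdot> ideal_mset_prod R (M + N)"
    using M assms(2) P by (intro ideal_mset_prod_add) auto
  then show ?case
    using add.IH[OF M] P ideal_ideal_mset_prod[of M] ideal_ideal_mset_prod[of N] M assms(2)
    by (simp add: ideal_mset_prod_add ideal_prod_assoc)
qed

lemma primeideal_ideal_mset_prod:
  assumes "primeideal P R" "\<And>Q. Q \<in># M \<Longrightarrow> ideal Q R" "ideal_mset_prod R M \<subseteq> P"
  shows "\<exists>Q\<in>#M. Q \<subseteq> P"
  using assms(2,3)
proof (induction M)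
  case empty
  then show ?case using primeideal.I_notcarr[OF assms(1)] ideal.Icarr[OF primeideal.axioms(1)[OF assms(1)]]
    by (auto simp: ideal_mset_prod_empty)
next
  case (add Q M)
  then show ?case
    using primeideal_divides_ideal_prod[OF assms(1), of Q "ideal_mset_prod R M"]
      ideal_mset_prod_add[of M Q] ideal_ideal_mset_prod[of M] by auto
qed

section \<open>Arithmetic modulo powers of a maximal ideal\<close>

lemma maximalideal_decompose_one:
  assumes "maximalideal P R" "w \<in> carrier R" "w \<notin> P"
  obtains r p where "r \<in> carrier R" "p \<in> P" "r \<otimes> w \<oplus> p = \<one>"
proof -
  interpret P: maximalideal P R by fact
  have id: "ideal (PIdl w <+> P) R"
    by (rule add_ideals[OF cgenideal_ideal[OF assms(2)] P.is_ideal])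
  have sub: "P \<subseteq> PIdl w <+> P"
  proof
    fix p assume p: "p \<in> P"
    have "\<zero> \<in> PIdl w" using additive_subgroup.zero_closed[OF ideal.axioms(1)[OF cgenideal_ideal[OF assms(2)]]] .
    moreover have "p = \<zero> \<oplus> p" using p P.Icarr by simp
    ultimately show "p \<in> PIdl w <+> P" using p unfolding set_add_def' by blast
  qed
  have "w \<in> PIdl w <+> P"
  proof -
    have "w = w \<oplus> \<zero>" using assms(2) by simp
    then show ?thesis using cgenideal_self[OF assms(2)] P.zero_closed unfolding set_add_def' by blast
  qed
  then have "PIdl w <+> P = carrier R"
    using P.I_maximal[OF id sub] ideal.Icarr[OF id] assms(3) by blast
  then have "\<one> \<in> PIdl w <+> P" by simp
  then show ?thesis using that unfolding set_add_def' cgenideal_def by auto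
qed

text \<open>Powers of a maximal ideal are primary. If z lies in P^k and r w + p = 1, then z = r (w
  z) + z p, where z p lies in P^(k+1) and w z does so by assumption.\<close>

lemma maximalideal_pow_cancel:
  assumes P: "maximalideal P R" and w: "w \<in> carrier R" "w \<notin> P" and z: "z \<in> carrier R"
    and "w \<otimes> z \<in> ideal_pow R P k"
  shows "z \<in> ideal_pow R P k"
  using assms(5)
proof (induction k)
  case 0
  then show ?case using z by (simp add: ideal_pow_0)
next
  case (Suc k)
  interpret P: maximalideal P R by fact
  interpret Q: ideal "ideal_pow R P (Suc k)" R by (rule ideal_ideal_pow[OF P.is_ideal])
  have "w \<otimes> z \<in> ideal_pow R P k"
    using Suc.prems ideal_pow_antimono[OF P.is_ideal, of k "Suc k"] by auto
  then have zk: "z \<in> ideal_pow R P k" by (rule Suc.IH)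
  obtain r p where rp: "r \<in> carrier R" "p \<in> P" "r \<otimes> w \<oplus> p = \<one>"
    using maximalideal_decompose_one[OF P w] .
  have "z = (r \<otimes> w \<oplus> p) \<otimes> z" using rp(3) z by simp
  also have "\<dots> = r \<otimes> (w \<otimes> z) \<oplus> z \<otimes> p"
    using rp(1) P.Icarr[OF rp(2)] w z by algebra
  finally have *: "z = r \<otimes> (w \<otimes> z) \<oplus> z \<otimes> p" .
  have "z \<otimes> p \<in> ideal_pow R P (Suc k)"
    unfolding ideal_pow_Suc using zk rp(2) by (rule ideal_prod.prod)
  moreover have "r \<otimes> (w \<otimes> z) \<in> ideal_pow R P (Suc k)"
    using Suc.prems rp(1) by (rule Q.I_l_closed)
  ultimately show ?case using Q.a_closed * by metis
qed

text \<open>In the product of r w + p = 1 and s w + q = 1 the only term without the factor w is p q,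
  which lies one power of P deeper. Thus w is invertible modulo every power of P.\<close>

lemma maximalideal_pow_comaximal:
  assumes P: "maximalideal P R" and w: "w \<in> carrier R" "w \<notin> P"
  obtains r p where "r \<in> carrier R" "p \<in> ideal_pow R P k" "r \<otimes> w \<oplus> p = \<one>"
proof -
  interpret P: maximalideal P R by fact
  have "\<exists>r\<in>carrier R. \<exists>p\<in>ideal_pow R P k. r \<otimes> w \<oplus> p = \<one>"
  proof (induction k)
    case 0
    then show ?case using w by (intro bexI[of _ \<zero>] bexI[of _ \<one>]) (auto simp: ideal_pow_0)
  next
    case (Suc k)
    then obtain r p where rp: "r \<in> carrier R" "p \<in> ideal_pow R P k" "r \<otimes> w \<oplus> p = \<one>" by blast
    have p: "p \<in> carrier R" using ideal.Icarr[OF ideal_ideal_pow[OF P.is_ideal] rp(2)] .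
    obtain s q where sq: "s \<in> carrier R" "q \<in> P" "s \<otimes> w \<oplus> q = \<one>"
      using maximalideal_decompose_one[OF P w] .
    have q: "q \<in> carrier R" using sq(2) by (rule P.Icarr)
    have "(r \<otimes> w \<otimes> s \<oplus> r \<otimes> q \<oplus> p \<otimes> s) \<otimes> w \<oplus> p \<otimes> q = (r \<otimes> w \<oplus> p) \<otimes> (s \<otimes> w \<oplus> q)"
      using rp(1) sq(1) p q w by algebra
    also have "\<dots> = \<one>" using rp(3) sq(3) by simp
    finally show ?case
      using rp sq p q w ideal_prod.prod[OF rp(2) sq(2), of R]
      by (intro bexI[of _ "r \<otimes> w \<otimes> s \<oplus> r \<otimes> q \<oplus> p \<otimes> s"] bexI[of _ "p \<otimes> q"]) (auto simp: ideal_pow_Suc)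
  qed
  then show ?thesis using that by blast
qed

text \<open>A Chinese remainder construction by hand: t + p^2 = 1 with t in the product of
  \<open>N\<close> and p in P, and y = t q + p^2. Then y is congruent to q modulo P^2 and to 1
  modulo each prime in \<open>N\<close>.\<close>

lemma exists_uniformizer:
  assumes P: "maximalideal P R" and q: "q \<in> P" "q \<notin> P \<cdot> P"
    and N: "\<And>Q. Q \<in># N \<Longrightarrow> primeideal Q R \<and> \<not> Q \<subseteq> P"
  obtains y where "y \<in> P" "y \<notin> P \<cdot> P" "\<And>Q. Q \<in># N \<Longrightarrow> y \<notin> Q"
proof -
  interpret P: maximalideal P R by fact
  interpret PP: ideal "P \<cdot> P" R by (rule ideal_prod_is_ideal[OF P.is_ideal P.is_ideal])
  have Nid: "\<And>Q. Q \<in># N \<Longrightarrow> ideal Q R" using N by (simp add: primeideal.axioms(1))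
  have "\<not> ideal_mset_prod R N \<subseteq> P"
    using primeideal_ideal_mset_prod[OF maximalideal_prime[OF P] Nid] N by blast
  then obtain w where w: "w \<in> ideal_mset_prod R N" "w \<notin> P" by blast
  interpret B: ideal "ideal_mset_prod R N" R using ideal_ideal_mset_prod Nid by blast
  have wc: "w \<in> carrier R" using B.Icarr[OF w(1)] .
  obtain r p where rp: "r \<in> carrier R" "p \<in> P" "r \<otimes> w \<oplus> p = \<one>"
    using maximalideal_decompose_one[OF P wc w(2)] .
  have pc: "p \<in> carrier R" and qc: "q \<in> carrier R" using rp(2) q(1) P.Icarr by auto
  \<comment> \<open>Substituting the relation into itself, 1 = r w + p = r w + p (r w + p), pushes
    the remainder from P into P^2; \<open>t\<close> collects all terms divisible by
    \<open>w\<close>.\<close>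
  define t where "t = (r \<otimes> (\<one> \<oplus> p)) \<otimes> w"
  have tB: "t \<in> ideal_mset_prod R N"
    unfolding t_def by (rule B.I_l_closed[OF w(1)]) (use rp pc in simp)
  then have tc: "t \<in> carrier R" by (rule B.Icarr)
  have "t \<oplus> p \<otimes> p = r \<otimes> w \<oplus> p \<otimes> (r \<otimes> w \<oplus> p)"
    unfolding t_def using rp(1) wc pc by algebra
  also have "\<dots> = \<one>" using rp pc by simp
  finally have one: "t \<oplus> p \<otimes> p = \<one>" .
  have pp: "p \<otimes> p \<in> P \<cdot> P" using rp(2) rp(2) by (rule ideal_prod.prod)
  define y where "y = t \<otimes> q \<oplus> p \<otimes> p"
  have "y \<in> P" unfolding y_def using q(1) rp(2) tc pc by (simp add: P.I_l_closed)
  moreover have "y \<notin> P \<cdot> P"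
  proof
    assume y: "y \<in> P \<cdot> P"
    have "q = (t \<oplus> p \<otimes> p) \<otimes> q" using one qc by simp
    also have "\<dots> = y \<oplus> (q \<ominus> \<one>) \<otimes> (p \<otimes> p)" unfolding y_def using tc pc qc by algebra
    finally have "q = y \<oplus> (q \<ominus> \<one>) \<otimes> (p \<otimes> p)" .
    moreover have "(q \<ominus> \<one>) \<otimes> (p \<otimes> p) \<in> P \<cdot> P" using PP.I_l_closed[OF pp, of "q \<ominus> \<one>"] qc by simp
    ultimately show False using y q(2) PP.a_closed by metis
  qed
  moreover have "y \<notin> Q" if Q: "Q \<in># N" for Q
  proof
    assume y: "y \<in> Q"
    interpret Q: primeideal Q R using N Q by blast
    have t: "t \<in> Q" using tB ideal_mset_prod_subset[OF Nid Q] by blast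
    have "\<one> = y \<oplus> (\<one> \<ominus> q) \<otimes> t"
      unfolding y_def one[symmetric] using tc pc qc one by algebra
    moreover have "(\<one> \<ominus> q) \<otimes> t \<in> Q" using t qc by (intro Q.I_l_closed) auto
    ultimately have "\<one> \<in> Q" using y Q.a_closed by metis
    then show False using Q.one_imp_carrier Q.I_notcarr by blast
  qed
  ultimately show ?thesis using that by blast
qed

text \<open>An intersection of distinct maximal ideals lies in their product. Distinctness gives w
  outside P in the product B of the others, and with r w + p = 1 both summands of z = (r z) w + p z
  lie in P B.\<close>

lemma mem_prod_maximalideals:
  assumes "finite S" "\<And>P. P \<in> S \<Longrightarrow> maximalideal P R" "z \<in> carrier R" "\<And>P. P \<in> S \<Longrightarrow> z \<in> P"
  shows "z \<in> ideal_mset_prod R (mset_set S)"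
  using assms
proof (induction S)
  case empty
  then show ?case by (simp add: ideal_mset_prod_empty)
next
  case (insert P S)
  let ?B = "ideal_mset_prod R (mset_set S)"
  have P: "maximalideal P R" and S: "\<And>Q. Q \<in> S \<Longrightarrow> maximalideal Q R" using insert.prems by auto
  interpret P: maximalideal P R by fact
  have Sid: "\<And>Q. Q \<in># mset_set S \<Longrightarrow> ideal Q R"
    using S insert.hyps by (auto simp: maximalideal.axioms(1))
  have "Q = P" if "Q \<in> S" "Q \<subseteq> P" for Q
    using maximalideal.I_maximal[OF S[OF that(1)] P.is_ideal that(2) P.a_subset] P.I_notcarr by blast
  moreover have "\<exists>Q\<in>#mset_set S. Q \<subseteq> P" if "?B \<subseteq> P"
    using primeideal_ideal_mset_prod[OF maximalideal_prime[OF P] Sid that] .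
  ultimately have "\<not> ?B \<subseteq> P" using insert.hyps by auto
  then obtain w where w: "w \<in> ?B" "w \<notin> P" by blast
  interpret B: ideal ?B R using ideal_ideal_mset_prod[OF Sid] .
  obtain r p where rp: "r \<in> carrier R" "p \<in> P" "r \<otimes> w \<oplus> p = \<one>"
    using maximalideal_decompose_one[OF P B.Icarr[OF w(1)] w(2)] .
  have zB: "z \<in> ?B" using insert by auto
  have zP: "z \<in> P" using insert.prems by auto
  have "z = (r \<otimes> w \<oplus> p) \<otimes> z" using rp(3) insert.prems by simp
  also have "\<dots> = (r \<otimes> z) \<otimes> w \<oplus> p \<otimes> z"
    using rp(1) P.Icarr[OF rp(2)] B.Icarr[OF w(1)] insert.prems(2) by algebra
  finally have *: "z = (r \<otimes> z) \<otimes> w \<oplus> p \<otimes> z" .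
  have "(r \<otimes> z) \<otimes> w \<in> P \<cdot> ?B" using P.I_l_closed[OF zP rp(1)] w(1) by (rule ideal_prod.prod)
  moreover have "p \<otimes> z \<in> P \<cdot> ?B" using rp(2) zB by (rule ideal_prod.prod)
  ultimately have "z \<in> P \<cdot> ?B" using ideal_prod.sum * by metis
  moreover have "ideal_mset_prod R (add_mset P (mset_set S)) = P \<cdot> ?B"
    using Sid P.is_ideal by (rule ideal_mset_prod_add)
  ultimately show ?case using insert.hyps by simp
qed

end

section \<open>Factorization of ideals in Dedekind domains\<close>

text \<open>This is the form of Noetherian induction used below, where \<open>S\<close> is a set of
  counterexamples: the chain condition puts the union of a nonempty chain into the chain.\<close>

lemma (in noetherian_ring) exists_maximal_in_ideals:
  assumes "S \<noteq> {}" "S \<subseteq> {I. ideal I R}"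
  shows "\<exists>M\<in>S. \<forall>I\<in>S. M \<subseteq> I \<longrightarrow> I = M"
proof (rule subset_Zorn)
  fix C assume C: "subset.chain S C"
  show "\<exists>U\<in>S. \<forall>I\<in>C. I \<subseteq> U"
  proof (cases "C = {}")
    case True
    then show ?thesis using assms(1) by auto
  next
    case False
    have "C \<subseteq> S" using C by (simp add: pred_on.chain_def)
    then have "subset.chain {I. ideal I R} C" using C assms(2) by (auto simp: pred_on.chain_def)
    then have "\<Union>C \<in> C" using ideal_chain_is_trivial False by blast
    then show ?thesis using \<open>C \<subseteq> S\<close> by (intro bexI[of _ "\<Union>C"]) auto
  qed
qed

lemma (in cring) PIdl_ideal_prod:
  assumes a: "a \<in> carrier R" and I: "ideal I R"
  shows "(PIdl a) \<cdot> I = (\<lambda>x. a \<otimes> x) ` I"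
proof
  interpret I: ideal I R by fact
  show "(PIdl a) \<cdot> I \<subseteq> (\<lambda>x. a \<otimes> x) ` I"
  proof
    fix z assume "z \<in> (PIdl a) \<cdot> I"
    then show "z \<in> (\<lambda>x. a \<otimes> x) ` I"
    proof induction
      case (prod i j)
      then obtain r where r: "r \<in> carrier R" "i = r \<otimes> a" unfolding cgenideal_def by auto
      have "i \<otimes> j = a \<otimes> (r \<otimes> j)" using r a I.Icarr[OF prod(2)] by (simp add: m_ac)
      then show ?case using I.I_l_closed[OF prod(2) r(1)] by blast
    next
      case (sum s t)
      then obtain x y where "x \<in> I" "y \<in> I" "s = a \<otimes> x" "t = a \<otimes> y" by auto
      then have "s \<oplus> t = a \<otimes> (x \<oplus> y)" "x \<oplus> y \<in> I" using a I.Icarr I.a_closed by (auto simp: r_distr)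
      then show ?case by blast
    qed
  qed
  show "(\<lambda>x. a \<otimes> x) ` I \<subseteq> (PIdl a) \<cdot> I"
    using cgenideal_self[OF a] by (auto intro: ideal_prod.prod)
qed

context dedekind_domain
begin

text \<open>If \<open>(b/a) I \<subseteq> I\<close> then all \<open>(b/a)\<^sup>n x\<close> with \<open>x \<in> I\<close> lie in \<open>R\<close>, so by the ascending chain condition
  one of them is a combination of the previous ones, which is a monic equation for \<open>b/a\<close>.\<close>

lemma divides_of_ideal_stable:
  assumes I: "ideal I R" "I \<noteq> {\<zero>}" and a: "a \<in> carrier R" "a \<noteq> \<zero>" and b: "b \<in> carrier R"
    and stable: "\<And>x. x \<in> I \<Longrightarrow> \<exists>y\<in>I. b \<otimes> x = a \<otimes> y"
  shows "a divides b"
proof -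
  interpret I: ideal I R by fact
  obtain x where x: "x \<in> I" "x \<noteq> \<zero>" using I.zero_closed I(2) by blast
  obtain f where f: "\<And>x. x \<in> I \<Longrightarrow> f x \<in> I \<and> b \<otimes> x = a \<otimes> f x" using stable by metis
  \<comment> \<open>\<open>y n\<close> plays the role of (b/a)^n x; \<open>pow_y\<close> expresses
    this without denominators.\<close>
  define y where "y n = (f ^^ n) x" for n
  have yI: "y n \<in> I" for n by (induction n) (use x f in \<open>auto simp: y_def\<close>)
  then have yc: "y n \<in> carrier R" for n by (rule I.Icarr)
  have xc: "x \<in> carrier R" using x(1) by (rule I.Icarr)
  have pow_y: "b [^] n \<otimes> x = a [^] n \<otimes> y n" for n :: nat
  proof (induction n)
    case 0
    then show ?case by (simp add: y_def)
  next
    case (Suc n)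
    have "b [^] Suc n \<otimes> x = b \<otimes> (b [^] n \<otimes> x)" using b xc by (simp add: m_ac)
    also have "\<dots> = a [^] n \<otimes> (b \<otimes> y n)" unfolding Suc using a b yc by (simp add: m_ac)
    also have "b \<otimes> y n = a \<otimes> y (Suc n)" using f[OF yI[of n]] by (simp add: y_def)
    finally show ?case using a yc by (simp add: m_ac)
  qed
  \<comment> \<open>\<open>K n\<close> is the ideal generated by y 0, ..., y (n - 1), an ascending
    sequence to which the chain condition applies.\<close>
  define K where "K = rec_nat {\<zero>} (\<lambda>n J. J <+> PIdl (y n))"
  have K0: "K 0 = {\<zero>}" and KS: "K (Suc n) = K n <+> PIdl (y n)" for n by (simp_all add: K_def)
  have Kid: "ideal (K n) R" for n
    by (induction n) (simp_all add: K0 KS zeroideal add_ideals cgenideal_ideal yc)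
  have Kmono: "K n \<subseteq> K (Suc n)" and yK: "y n \<in> K (Suc n)" for n
  proof -
    interpret J: ideal "PIdl (y n)" R by (rule cgenideal_ideal[OF yc])
    interpret K: ideal "K n" R by (rule Kid)
    show "K n \<subseteq> K (Suc n)"
    proof
      fix z assume "z \<in> K n"
      then show "z \<in> K (Suc n)" unfolding KS set_add_def'
        using J.zero_closed K.Icarr[of z] r_zero[of z] by (metis (no_types, lifting) UN_iff singletonI)
    qed
    show "y n \<in> K (Suc n)" unfolding KS set_add_def'
      using cgenideal_self[OF yc[of n]] K.zero_closed l_zero[OF yc[of n]] by (metis (no_types, lifting) UN_iff singletonI)
  qed
  have comb: "\<exists>r \<in> {..<n} \<rightarrow> carrier R. z = (\<Oplus>i\<in>{..<n}. r i \<otimes> y i)" if "z \<in> K n" for z n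
    using that
  proof (induction n arbitrary: z)
    case 0
    then show ?case by (auto simp: K0)
  next
    case (Suc n)
    then obtain k s where k: "k \<in> K n" "s \<in> carrier R" "z = k \<oplus> s \<otimes> y n"
      unfolding KS set_add_def' cgenideal_def by auto
    obtain r where r: "r \<in> {..<n} \<rightarrow> carrier R" "k = (\<Oplus>i\<in>{..<n}. r i \<otimes> y i)" using Suc.IH[OF k(1)] by blast
    define r' where "r' = r(n := s)"
    have r': "r' \<in> {..<Suc n} \<rightarrow> carrier R" using r(1) k(2) by (auto simp: r'_def Pi_iff)
    have cl: "(\<lambda>i. r i \<otimes> y i) \<in> {..<n} \<rightarrow> carrier R" using r(1) yc by auto
    have "(\<Oplus>i\<in>{..<n}. r' i \<otimes> y i) = k"
      unfolding r(2) using cl by (intro finsum_cong') (auto simp: r'_def)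
    moreover have "(\<Oplus>i\<in>insert n {..<n}. r' i \<otimes> y i) = r' n \<otimes> y n \<oplus> (\<Oplus>i\<in>{..<n}. r' i \<otimes> y i)"
      using r' yc by (intro finsum_insert) (auto simp: Pi_iff)
    moreover have "k \<in> carrier R" using ideal.Icarr[OF Kid k(1)] .
    ultimately have "z = (\<Oplus>i\<in>{..<Suc n}. r' i \<otimes> y i)"
      using k yc by (simp add: lessThan_Suc r'_def a_comm)
    then show ?case using r' by blast
  qed
  have "K m \<subseteq> K n" if "m \<le> n" for m n using that Kmono by (rule lift_Suc_mono_le[rotated])
  then have "K m \<subseteq> K n \<or> K n \<subseteq> K m" for m n using nat_le_linear by blast
  then have "subset.chain {I. ideal I R} (range K)"
    using Kid unfolding pred_on.chain_def by blast
  then have "\<Union>(range K) \<in> range K" by (intro ideal_chain_is_trivial) auto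
  then obtain n where "\<Union>(range K) = K n" by blast
  then have "y n \<in> K n" using yK by blast
  then obtain r where r: "r \<in> {..<n} \<rightarrow> carrier R" "y n = (\<Oplus>i\<in>{..<n}. r i \<otimes> y i)" using comb by blast
  have rc: "r i \<in> carrier R" if "i < n" for i using r(1) that by auto
  \<comment> \<open>Multiplying the relation for \<open>y n\<close> by a^n turns each r_i y_i into
    r_i b^i a^(n-i) x; cancelling x leaves b^n = E, the homogenized monic equation.\<close>
  define E where "E = (\<Oplus>i\<in>{..<n}. r i \<otimes> b [^] i \<otimes> a [^] (n - i))"
  have Ecl: "(\<lambda>i. r i \<otimes> b [^] i \<otimes> a [^] (n - i)) \<in> {..<n} \<rightarrow> carrier R" using rc a b by auto
  then have Ec: "E \<in> carrier R" unfolding E_def by (rule finsum_closed)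
  have "a [^] n \<otimes> y n = (\<Oplus>i\<in>{..<n}. a [^] n \<otimes> (r i \<otimes> y i))"
    unfolding r(2) using rc yc a by (intro finsum_rdistr) auto
  also have "\<dots> = (\<Oplus>i\<in>{..<n}. (r i \<otimes> b [^] i \<otimes> a [^] (n - i)) \<otimes> x)"
  proof (rule finsum_cong')
    fix i assume "i \<in> {..<n}"
    then have i: "i < n" by simp
    have "a [^] n \<otimes> (r i \<otimes> y i) = a [^] (n - i) \<otimes> a [^] i \<otimes> (r i \<otimes> y i)"
      using i a by (simp add: nat_pow_mult)
    also have "\<dots> = r i \<otimes> a [^] (n - i) \<otimes> (a [^] i \<otimes> y i)"
      using rc[OF i] yc a by (simp add: m_ac)
    also have "\<dots> = (r i \<otimes> b [^] i \<otimes> a [^] (n - i)) \<otimes> x"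
      unfolding pow_y[symmetric] using rc[OF i] xc a b by (simp add: m_ac)
    finally show "a [^] n \<otimes> (r i \<otimes> y i) = (r i \<otimes> b [^] i \<otimes> a [^] (n - i)) \<otimes> x" .
  qed (use Ecl xc in auto)
  also have "\<dots> = E \<otimes> x" unfolding E_def using Ecl xc by (intro finsum_ldistr[symmetric]) auto
  finally have "b [^] n \<otimes> x = E \<otimes> x" by (simp add: pow_y)
  then have bE: "b [^] n = E" using x(2) xc b Ec by (simp add: m_rcancel)
  have "(\<Oplus>i\<in>{..<n}. (\<ominus> r i) \<otimes> b [^] i \<otimes> a [^] (n - i)) = (\<Oplus>i\<in>{..<n}. (\<ominus> \<one>) \<otimes> (r i \<otimes> b [^] i \<otimes> a [^] (n - i)))"
    using Ecl rc a b by (intro finsum_cong') (auto simp: l_minus)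
  also have "\<dots> = (\<ominus> \<one>) \<otimes> E"
    unfolding E_def using Ecl by (intro finsum_rdistr[symmetric]) auto
  finally have "b [^] n \<oplus> (\<Oplus>i\<in>{..<n}. (\<ominus> r i) \<otimes> b [^] i \<otimes> a [^] (n - i)) = \<zero>"
    using bE Ec by (simp add: l_minus r_neg)
  then show ?thesis
    using rc by (intro integrally_closed[OF b a, of "\<lambda>i. \<ominus> r i" n]) auto
qed

section \<open>Unique factorization of nonzero ideals\<close>

definition prime_mset :: "'a set multiset \<Rightarrow> bool"
  where "prime_mset M \<longleftrightarrow> (\<forall>P\<in>#M. primeideal P R \<and> P \<noteq> {\<zero>})"

lemma prime_mset_ideal: "prime_mset M \<Longrightarrow> P \<in># M \<Longrightarrow> ideal P R"
  by (simp add: prime_mset_def primeideal.axioms(1))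

lemma prime_mset_maximal: "prime_mset M \<Longrightarrow> P \<in># M \<Longrightarrow> maximalideal P R"
  by (simp add: prime_mset_def nonzero_prime_maximal)

lemma maximalideal_eqI:
  assumes "maximalideal P R" "maximalideal Q R" "P \<subseteq> Q"
  shows "P = Q"
  using assms maximalideal.I_maximal[OF assms(1) maximalideal.axioms(1)[OF assms(2)]]
    maximalideal.I_notcarr[OF assms(2)] ideal.Icarr[OF maximalideal.axioms(1)[OF assms(2)]] by blast

lemma ideal_prime_mset_prod: "prime_mset M \<Longrightarrow> ideal (ideal_mset_prod R M) R"
  using ideal_ideal_mset_prod prime_mset_ideal by blast

lemma prime_mset_prod_subset: "prime_mset M \<Longrightarrow> P \<in># M \<Longrightarrow> ideal_mset_prod R M \<subseteq> P"
  using ideal_mset_prod_subset prime_mset_ideal by blast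

lemma prime_mset_prod_add:
  "prime_mset M \<Longrightarrow> ideal P R \<Longrightarrow> ideal_mset_prod R (add_mset P M) = P \<cdot> ideal_mset_prod R M"
  using ideal_mset_prod_add prime_mset_ideal by blast

text \<open>A prime containing the product contains some factor, and since both are maximal the
  containment is an equality.\<close>

lemma prime_mset_memI:
  assumes "primeideal P R" "P \<noteq> {\<zero>}" "prime_mset M" "ideal_mset_prod R M \<subseteq> P"
  shows "P \<in># M"
proof -
  obtain Q where Q: "Q \<in># M" "Q \<subseteq> P"
    using primeideal_ideal_mset_prod[OF assms(1) _ assms(4)] prime_mset_ideal[OF assms(3)] by blast
  then show ?thesis
    using maximalideal_eqI[OF prime_mset_maximal[OF assms(3) Q(1)] nonzero_prime_maximal[OF assms(1,2)]] by simp
qed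

text \<open>A maximal counterexample J is neither R nor prime, so it contains a b with a and b
  outside J. The larger ideals J + (a) and J + (b) contain products of primes, and their product
  lies in J.\<close>

lemma exists_prime_mset_subset:
  assumes "ideal I R" "I \<noteq> {\<zero>}"
  shows "\<exists>M. prime_mset M \<and> ideal_mset_prod R M \<subseteq> I"
proof (rule ccontr)
  assume contra: "\<not> ?thesis"
  define S where "S = {I. ideal I R \<and> I \<noteq> {\<zero>} \<and> \<not> (\<exists>M. prime_mset M \<and> ideal_mset_prod R M \<subseteq> I)}"
  have "\<exists>J\<in>S. \<forall>I\<in>S. J \<subseteq> I \<longrightarrow> I = J"
    using contra assms by (intro exists_maximal_in_ideals) (auto simp: S_def)
  then obtain J where J: "J \<in> S" and max: "\<And>I. I \<in> S \<Longrightarrow> J \<subseteq> I \<Longrightarrow> I = J" by blast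
  interpret J: ideal J R using J by (simp add: S_def)
  have none: "\<not> ideal_mset_prod R M \<subseteq> J" if "prime_mset M" for M using J that by (auto simp: S_def)
  have "\<not> primeideal J R"
    using none[of "{#J#}"] J ideal_mset_prod_subset[of "{#J#}" J] J.is_ideal by (auto simp: prime_mset_def S_def)
  moreover have "carrier R \<noteq> J"
    using none[of "{#}"] by (auto simp: prime_mset_def ideal_mset_prod_empty)
  ultimately obtain a b where ab: "a \<in> carrier R" "b \<in> carrier R" "a \<otimes> b \<in> J" "a \<notin> J" "b \<notin> J"
    using J.primeidealCD[OF is_cring] by blast
  have ext: "\<exists>M. prime_mset M \<and> ideal_mset_prod R M \<subseteq> J <+> PIdl c" if c: "c \<in> carrier R" "c \<notin> J" for c
  proof (rule ccontr)
    assume no: "\<not> ?thesis"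
    interpret C: ideal "PIdl c" R by (rule cgenideal_ideal[OF c(1)])
    have sub: "J \<subseteq> J <+> PIdl c"
    proof
      fix z assume "z \<in> J"
      then show "z \<in> J <+> PIdl c" unfolding set_add_def'
        using C.zero_closed J.Icarr[of z] r_zero[of z] by (metis (no_types, lifting) UN_iff singletonI)
    qed
    have "c \<in> J <+> PIdl c" unfolding set_add_def'
      using cgenideal_self[OF c(1)] J.zero_closed l_zero[OF c(1)] by (metis (no_types, lifting) UN_iff singletonI)
    moreover have "J <+> PIdl c \<noteq> {\<zero>}" using sub J J.zero_closed by (auto simp: S_def)
    then have "J <+> PIdl c \<in> S"
      using no add_ideals[OF J.is_ideal C.is_ideal] by (auto simp: S_def)
    ultimately show False using max sub c(2) by blast
  qed
  obtain M N where M: "prime_mset M" "ideal_mset_prod R M \<subseteq> J <+> PIdl a"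
    and N: "prime_mset N" "ideal_mset_prod R N \<subseteq> J <+> PIdl b"
    using ext ab by meson
  have "ideal_mset_prod R (M + N) = ideal_mset_prod R M \<cdot> ideal_mset_prod R N"
    using M N by (intro ideal_mset_prod_union) (auto simp: prime_mset_ideal)
  also have "\<dots> \<subseteq> J"
  proof (rule ideal_prod_subsetI[OF J.is_ideal])
    fix i j assume "i \<in> ideal_mset_prod R M" "j \<in> ideal_mset_prod R N"
    then have "i \<in> J <+> PIdl a" "j \<in> J <+> PIdl b" using M N by auto
    then obtain u r v s where uv: "u \<in> J" "r \<in> carrier R" "i = u \<oplus> r \<otimes> a" "v \<in> J" "s \<in> carrier R" "j = v \<oplus> s \<otimes> b"
      unfolding set_add_def' cgenideal_def by auto
    have c: "u \<in> carrier R" "v \<in> carrier R" using uv J.Icarr by auto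
    have "i \<otimes> j = j \<otimes> u \<oplus> ((r \<otimes> a) \<otimes> v \<oplus> (r \<otimes> s) \<otimes> (a \<otimes> b))"
      unfolding uv(3,6) using uv(2,5) ab(1,2) c by algebra
    moreover have "j \<otimes> u \<in> J" "(r \<otimes> a) \<otimes> v \<in> J" "(r \<otimes> s) \<otimes> (a \<otimes> b) \<in> J"
      using uv ab c by (auto intro!: J.I_l_closed)
    ultimately show "i \<otimes> j \<in> J" using J.a_closed by metis
  qed
  finally have "ideal_mset_prod R (M + N) \<subseteq> J" .
  moreover have "prime_mset (M + N)" using M(1) N(1) by (auto simp: prime_mset_def)
  ultimately show False using none by blast
qed

text \<open>J/a is the fractional ideal inverse to P, and b/a is an element of it outside R. The
  equation P J = (a) holds because b/a, not being in R, cannot map P into itself: some product p b/a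
  is then a unit modulo P.\<close>

lemma prime_ideal_inverse:
  assumes P: "primeideal P R" "P \<noteq> {\<zero>}"
  obtains a b J where "a \<in> carrier R" "a \<noteq> \<zero>" "b \<in> J" "\<not> a divides b" "ideal J R" "a \<in> J" "P \<cdot> J = PIdl a"
proof -
  interpret P: primeideal P R by fact
  have Pmax: "maximalideal P R" using P by (rule nonzero_prime_maximal)
  obtain a where a: "a \<in> P" "a \<noteq> \<zero>" using P(2) P.zero_closed by blast
  have ac: "a \<in> carrier R" using a(1) by (rule P.Icarr)
  interpret A: ideal "PIdl a" R using ac by (rule cgenideal_ideal)
  have "PIdl a \<noteq> {\<zero>}" using cgenideal_self[OF ac] a(2) by auto
  then have "\<exists>M. prime_mset M \<and> ideal_mset_prod R M \<subseteq> PIdl a" by (intro exists_prime_mset_subset[OF A.is_ideal])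
  then obtain M0 where M0: "prime_mset M0 \<and> ideal_mset_prod R M0 \<subseteq> PIdl a" by blast
  obtain M where M: "prime_mset M" "ideal_mset_prod R M \<subseteq> PIdl a"
    and min: "\<And>N. prime_mset N \<Longrightarrow> ideal_mset_prod R N \<subseteq> PIdl a \<Longrightarrow> size M \<le> size N"
    using ex_has_least_nat[of "\<lambda>M. prime_mset M \<and> ideal_mset_prod R M \<subseteq> PIdl a", OF M0, of size] by blast
  have "ideal_mset_prod R M \<subseteq> P"
    using M(2) cgenideal_minimal[OF P.is_ideal a(1)] by blast
  then have "P \<in># M" by (rule prime_mset_memI[OF P M(1)])
  then obtain N where N: "M = add_mset P N" by (metis mset_add)
  have Npr: "prime_mset N" using M(1) by (simp add: N prime_mset_def)
  \<comment> \<open>Minimality of the number of factors is used here: omitting P leaves a product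
    not contained in (a), and any b in it outside (a) still satisfies b P \<subseteq> (a).\<close>
  have "\<not> ideal_mset_prod R N \<subseteq> PIdl a" using min[OF Npr] by (auto simp: N)
  then obtain b where b: "b \<in> ideal_mset_prod R N" "b \<notin> PIdl a" by blast
  have bc: "b \<in> carrier R" using b(1) ideal.Icarr[OF ideal_prime_mset_prod[OF Npr]] by blast
  have PM: "p \<otimes> b \<in> PIdl a" if "p \<in> P" for p
    using ideal_prod.prod[OF that b(1), of R] M(2) prime_mset_prod_add[OF Npr P.is_ideal]
    by (auto simp: N)
  \<comment> \<open>This is the ideal quotient (a) : P, so that J/a consists of the fractions
    carrying P into R.\<close>
  define J where "J = {x \<in> carrier R. \<forall>p\<in>P. p \<otimes> x \<in> PIdl a}"
  have J: "ideal J R"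
  proof (rule idealI[OF ring_axioms])
    show "subgroup J (add_monoid R)"
    proof (rule add.subgroupI)
      show "J \<noteq> {}" using A.zero_closed P.Icarr by (auto simp: J_def intro!: exI[of _ \<zero>])
      show "\<ominus> x \<in> J" if "x \<in> J" for x
        using that P.Icarr A.a_inv_closed by (auto simp: J_def r_minus)
      show "x \<oplus> y \<in> J" if "x \<in> J" "y \<in> J" for x y
        using that P.Icarr by (auto simp: J_def r_distr)
    qed (auto simp: J_def)
  next
    fix x r assume x: "x \<in> J" and r: "r \<in> carrier R"
    have "p \<otimes> (r \<otimes> x) \<in> PIdl a" if "p \<in> P" for p
    proof -
      have "p \<otimes> (r \<otimes> x) = r \<otimes> (p \<otimes> x)" using that r x P.Icarr by (simp add: J_def m_lcomm)
      then show ?thesis using A.I_l_closed[OF _ r] x that by (simp add: J_def)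
    qed
    then show "r \<otimes> x \<in> J" using r x by (simp add: J_def)
    then show "x \<otimes> r \<in> J" using r x by (simp add: J_def m_comm)
  qed
  have bJ: "b \<in> J" unfolding J_def using bc PM by blast
  have aJ: "a \<in> J" unfolding J_def using ac P.Icarr A.I_l_closed[OF cgenideal_self[OF ac]] by blast
  have PJid: "ideal (P \<cdot> J) R" using P.is_ideal J by (rule ideal_prod_is_ideal)
  interpret PJ: ideal "P \<cdot> J" R by fact
  have sub: "P \<cdot> J \<subseteq> PIdl a" by (rule ideal_prod_subsetI[OF A.is_ideal]) (simp add: J_def)
  have ndvd: "\<not> a divides b" using b(2) ac unfolding factor_def cgenideal_def by (auto simp: m_comm)
  have "\<exists>p\<in>P. \<not> (\<exists>y\<in>P. b \<otimes> p = a \<otimes> y)"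
    using divides_of_ideal_stable[OF P.is_ideal P(2) ac a(2) bc] ndvd by blast
  then obtain p where p: "p \<in> P" "\<And>y. y \<in> P \<Longrightarrow> b \<otimes> p \<noteq> a \<otimes> y" by blast
  have pc: "p \<in> carrier R" using p(1) by (rule P.Icarr)
  obtain w where w: "w \<in> carrier R" "p \<otimes> b = w \<otimes> a" using PM[OF p(1)] unfolding cgenideal_def by blast
  have "w \<notin> P" using p(2)[of w] w bc pc ac by (auto simp: m_comm)
  then obtain r q where rq: "r \<in> carrier R" "q \<in> P" "r \<otimes> w \<oplus> q = \<one>"
    using maximalideal_decompose_one[OF Pmax w(1)] by blast
  have qc: "q \<in> carrier R" using rq(2) by (rule P.Icarr)
  \<comment> \<open>Expanding a by r w + q = 1 exhibits it in P J, because w a = p b and both a and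
    b lie in J.\<close>
  have "a = (r \<otimes> w \<oplus> q) \<otimes> a" using rq(3) ac by simp
  also have "\<dots> = r \<otimes> (w \<otimes> a) \<oplus> q \<otimes> a" using rq(1) qc w(1) ac by algebra
  finally have "a = r \<otimes> (p \<otimes> b) \<oplus> q \<otimes> a" by (simp add: w(2))
  moreover have "r \<otimes> (p \<otimes> b) \<in> P \<cdot> J" "q \<otimes> a \<in> P \<cdot> J"
    using rq p(1) bJ aJ by (auto intro: PJ.I_l_closed ideal_prod.prod)
  ultimately have "a \<in> P \<cdot> J" using PJ.a_closed by metis
  then have "PIdl a \<subseteq> P \<cdot> J" by (rule cgenideal_minimal[OF PJid])
  then show ?thesis using that[OF ac a(2) bJ ndvd J aJ] sub by blast
qed

text \<open>Up to the scalar a, multiplication by J undoes multiplication by P.\<close>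

lemma ideal_inverse_prod:
  assumes "ideal P R" "ideal J R" "P \<cdot> J = PIdl a" "a \<in> carrier R" "ideal I R"
  shows "P \<cdot> (J \<cdot> I) = (\<otimes>) a ` I" "J \<cdot> (P \<cdot> I) = (\<otimes>) a ` I"
proof -
  have "P \<cdot> (J \<cdot> I) = P \<cdot> J \<cdot> I" by (rule ideal_prod_assoc[OF assms(1,2,5), symmetric])
  then show 1: "P \<cdot> (J \<cdot> I) = (\<otimes>) a ` I" using PIdl_ideal_prod[OF assms(4,5)] by (simp only: assms(3))
  have "J \<cdot> (P \<cdot> I) = J \<cdot> P \<cdot> I" by (rule ideal_prod_assoc[OF assms(2,1,5), symmetric])
  also have "J \<cdot> P = P \<cdot> J" by (rule ideal_prod_commute[OF assms(2,1)])
  also have "P \<cdot> J \<cdot> I = P \<cdot> (J \<cdot> I)" by (rule ideal_prod_assoc[OF assms(1,2,5)])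
  finally show "J \<cdot> (P \<cdot> I) = (\<otimes>) a ` I" by (simp only: 1)
qed

lemma mult_image_subset_cancel:
  assumes "a \<in> carrier R" "a \<noteq> \<zero>" "(\<otimes>) a ` I \<subseteq> (\<otimes>) a ` K" "I \<subseteq> carrier R" "K \<subseteq> carrier R"
  shows "I \<subseteq> K"
proof
  fix x assume x: "x \<in> I"
  then obtain y where y: "y \<in> K" "a \<otimes> x = a \<otimes> y" using assms(3) by blast
  then have "x = y" using m_lcancel[OF assms(2,1)] x assms(4,5) by blast
  then show "x \<in> K" using y(1) by simp
qed

text \<open>Multiplying by J turns the inclusion into a I \<subseteq> a K, and a is cancelled
  elementwise.\<close>

lemma prime_ideal_prod_cancel:
  assumes P: "primeideal P R" "P \<noteq> {\<zero>}" and I: "ideal I R" and K: "ideal K R" and sub: "P \<cdot> I \<subseteq> P \<cdot> K"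
  shows "I \<subseteq> K"
proof -
  obtain a b J where a: "a \<in> carrier R" "a \<noteq> \<zero>" and J: "ideal J R" "P \<cdot> J = PIdl a"
    using prime_ideal_inverse[OF P] by metis
  have Pid: "ideal P R" using P(1) by (rule primeideal.axioms(1))
  have "J \<cdot> (P \<cdot> I) \<subseteq> J \<cdot> (P \<cdot> K)" by (rule ideal_prod_mono[OF order_refl sub])
  then have "(\<otimes>) a ` I \<subseteq> (\<otimes>) a ` K"
    using ideal_inverse_prod(2)[OF Pid J a(1) I] ideal_inverse_prod(2)[OF Pid J a(1) K] by simp
  then show ?thesis
    by (rule mult_image_subset_cancel[OF a]) (use ideal.Icarr[OF I] ideal.Icarr[OF K] in blast)+
qed

text \<open>To contain is to divide: K is J I divided by a, possible since J I \<subseteq> J P =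
  (a). The strict inclusion of I in K drives the Noetherian induction that factors every nonzero
  ideal.\<close>

lemma prime_ideal_contains_imp_factor:
  assumes P: "primeideal P R" "P \<noteq> {\<zero>}" and I: "ideal I R" "I \<noteq> {\<zero>}" "I \<subseteq> P"
  obtains K where "ideal K R" "I = P \<cdot> K" "I \<subset> K"
proof -
  obtain a b J where a: "a \<in> carrier R" "a \<noteq> \<zero>" and b: "b \<in> J" "\<not> a divides b"
    and J: "ideal J R" "a \<in> J" "P \<cdot> J = PIdl a"
    using prime_ideal_inverse[OF P] by metis
  have Pid: "ideal P R" using P(1) by (rule primeideal.axioms(1))
  interpret JI: ideal "J \<cdot> I" R using J(1) I(1) by (rule ideal_prod_is_ideal)
  have bc: "b \<in> carrier R" using b(1) by (rule ideal.Icarr[OF J(1)])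
  have Ic: "I \<subseteq> carrier R" using ideal.Icarr[OF I(1)] by blast
  have JI: "J \<cdot> I \<subseteq> PIdl a"
    using ideal_prod_mono[OF order_refl I(3), of R J] ideal_prod_commute[OF J(1) Pid] J(3) by simp
  define K where "K = {k \<in> carrier R. a \<otimes> k \<in> J \<cdot> I}"
  have K: "ideal K R"
  proof (rule idealI[OF ring_axioms])
    show "subgroup K (add_monoid R)"
    proof (rule add.subgroupI)
      show "K \<noteq> {}" using a JI.zero_closed by (auto simp: K_def intro!: exI[of _ \<zero>])
      show "\<ominus> x \<in> K" if "x \<in> K" for x
        using that a JI.a_inv_closed by (auto simp: K_def r_minus)
      show "x \<oplus> y \<in> K" if "x \<in> K" "y \<in> K" for x y
        using that a by (auto simp: K_def r_distr)
    qed (auto simp: K_def)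
  next
    fix x r assume x: "x \<in> K" and r: "r \<in> carrier R"
    have "a \<otimes> (r \<otimes> x) = r \<otimes> (a \<otimes> x)" using r x a by (simp add: K_def m_lcomm)
    then show "r \<otimes> x \<in> K" using JI.I_l_closed[OF _ r] r x by (simp add: K_def)
    then show "x \<otimes> r \<in> K" using r x by (simp add: K_def m_comm)
  qed
  have Kc: "K \<subseteq> carrier R" by (auto simp: K_def)
  have aK: "(\<otimes>) a ` K = J \<cdot> I"
  proof
    show "J \<cdot> I \<subseteq> (\<otimes>) a ` K"
    proof
      fix z assume z: "z \<in> J \<cdot> I"
      then obtain k where "k \<in> carrier R" "z = k \<otimes> a" using JI unfolding cgenideal_def by blast
      then show "z \<in> (\<otimes>) a ` K" using z a m_comm by (auto simp: K_def image_iff)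
    qed
  qed (auto simp: K_def)
  have "(\<otimes>) a ` I = P \<cdot> (J \<cdot> I)"
    using ideal_inverse_prod(1)[OF Pid J(1,3) a(1) I(1)] by simp
  also have "\<dots> = P \<cdot> ((PIdl a) \<cdot> K)" using PIdl_ideal_prod[OF a(1) K] aK by simp
  also have "\<dots> = (PIdl a) \<cdot> (P \<cdot> K)"
    using ideal_prod_assoc ideal_prod_commute Pid K cgenideal_ideal[OF a(1)] by metis
  also have "\<dots> = (\<otimes>) a ` (P \<cdot> K)" by (rule PIdl_ideal_prod[OF a(1) ideal_prod_is_ideal[OF Pid K]])
  finally have "(\<otimes>) a ` I = (\<otimes>) a ` (P \<cdot> K)" .
  then have img: "(\<otimes>) a ` I \<subseteq> (\<otimes>) a ` (P \<cdot> K)" "(\<otimes>) a ` (P \<cdot> K) \<subseteq> (\<otimes>) a ` I" by simp_all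
  have IPK: "I = P \<cdot> K"
    using mult_image_subset_cancel[OF a img(1) Ic ideal_prod_in_carrier[OF Pid K]]
      mult_image_subset_cancel[OF a img(2) ideal_prod_in_carrier[OF Pid K] Ic] by (rule equalityI)
  then have "I \<subseteq> K" using ideal_prod_inter[OF Pid K] by blast
  \<comment> \<open>If K were I, then b I \<subseteq> J I = a I, so b/a would map I into itself and
    a would divide b.\<close>
  moreover have "I \<noteq> K"
  proof
    assume IK: "I = K"
    have "\<exists>y\<in>I. b \<otimes> x = a \<otimes> y" if "x \<in> I" for x
    proof -
      have "b \<otimes> x \<in> (\<otimes>) a ` I" using ideal_prod.prod[OF b(1) that, of R] aK by (simp add: IK)
      then show ?thesis by blast
    qed
    then show False using divides_of_ideal_stable[OF I(1,2) a bc] b(2) by blast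
  qed
  ultimately show ?thesis using that K IPK by blast
qed

lemma exists_maximal_supset:
  assumes "ideal I R" "I \<noteq> carrier R"
  shows "\<exists>P. maximalideal P R \<and> I \<subseteq> P"
proof -
  let ?S = "{J. ideal J R \<and> J \<noteq> carrier R \<and> I \<subseteq> J}"
  have "\<exists>P\<in>?S. \<forall>J\<in>?S. P \<subseteq> J \<longrightarrow> J = P" using assms by (intro exists_maximal_in_ideals) auto
  then obtain P where "P \<in> ?S" "\<forall>J\<in>?S. P \<subseteq> J \<longrightarrow> J = P" by blast
  then show ?thesis by (intro exI[of _ P] conjI maximalidealI) auto
qed

text \<open>A maximal counterexample is proper, hence lies in a maximal ideal P and equals P K with
  K strictly larger; a factorization of K then yields one of the counterexample.\<close>

lemma exists_prime_mset:
  assumes "ideal I R" "I \<noteq> {\<zero>}"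
  shows "\<exists>M. prime_mset M \<and> I = ideal_mset_prod R M"
proof (rule ccontr)
  assume contra: "\<not> ?thesis"
  define S where "S = {I. ideal I R \<and> I \<noteq> {\<zero>} \<and> \<not> (\<exists>M. prime_mset M \<and> I = ideal_mset_prod R M)}"
  have "\<exists>J\<in>S. \<forall>I\<in>S. J \<subseteq> I \<longrightarrow> I = J"
    using contra assms by (intro exists_maximal_in_ideals) (auto simp: S_def)
  then obtain J where J: "J \<in> S" and max: "\<And>I. I \<in> S \<Longrightarrow> J \<subseteq> I \<Longrightarrow> I = J" by blast
  have none: "J \<noteq> ideal_mset_prod R M" if "prime_mset M" for M using J that by (auto simp: S_def)
  have Jid: "ideal J R" "J \<noteq> {\<zero>}" using J by (auto simp: S_def)
  have "J \<noteq> carrier R" using none[of "{#}"] by (auto simp: prime_mset_def ideal_mset_prod_empty)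
  then obtain P where P: "maximalideal P R" "J \<subseteq> P" using exists_maximal_supset Jid by blast
  have Ppr: "primeideal P R" using maximalideal_prime[OF P(1)] .
  have P0: "P \<noteq> {\<zero>}" using P(2) Jid additive_subgroup.zero_closed[OF ideal.axioms(1)[OF Jid(1)]] by blast
  obtain K where K: "ideal K R" "J = P \<cdot> K" "J \<subset> K"
    using prime_ideal_contains_imp_factor[OF Ppr P0 Jid P(2)] .
  have "K \<noteq> {\<zero>}" using K(3) additive_subgroup.zero_closed[OF ideal.axioms(1)[OF Jid(1)]] by blast
  moreover have "K \<notin> S" using max[of K] K(3) by blast
  ultimately obtain M where M: "prime_mset M" "K = ideal_mset_prod R M" using K(1) by (auto simp: S_def)
  have "J = ideal_mset_prod R (add_mset P M)"
    using K(2) M(2) prime_mset_prod_add[OF M(1) primeideal.axioms(1)[OF Ppr]] by simp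
  moreover have "prime_mset (add_mset P M)" using M(1) Ppr P0 by (simp add: prime_mset_def)
  ultimately show False using none by blast
qed

text \<open>Each prime of \<open>M\<close> contains the common product, therefore occurs in
  \<open>N\<close>, and cancels from both sides.\<close>

lemma prime_mset_unique:
  assumes "prime_mset M" "prime_mset N" "ideal_mset_prod R M = ideal_mset_prod R N"
  shows "M = N"
  using assms
proof (induction M arbitrary: N)
  case empty
  show ?case
  proof (rule ccontr)
    assume "{#} \<noteq> N"
    then obtain Q where Q: "Q \<in># N" by auto
    have "carrier R \<subseteq> Q"
      using prime_mset_prod_subset[OF empty(2) Q] empty(3) by (simp add: ideal_mset_prod_empty)
    then show False
      using prime_mset_maximal[OF empty(2) Q] maximalideal.I_notcarr ideal.Icarr[OF prime_mset_ideal[OF empty(2) Q]] by blast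
  qed
next
  case (add P M)
  have P: "primeideal P R" "P \<noteq> {\<zero>}" and M: "prime_mset M" using add.prems by (auto simp: prime_mset_def)
  have Pid: "ideal P R" using P(1) by (rule primeideal.axioms(1))
  have eqM: "ideal_mset_prod R (add_mset P M) = P \<cdot> ideal_mset_prod R M"
    using M Pid by (rule prime_mset_prod_add)
  have "ideal_mset_prod R N \<subseteq> P"
    using prime_mset_prod_subset[OF add.prems(1), of P] add.prems(3) by simp
  then have "P \<in># N" by (rule prime_mset_memI[OF P add.prems(2)])
  then obtain N' where N': "N = add_mset P N'" by (metis mset_add)
  then have N'p: "prime_mset N'" using add.prems(2) by (simp add: prime_mset_def)
  have eqN: "ideal_mset_prod R N = P \<cdot> ideal_mset_prod R N'"
    unfolding N' using N'p Pid by (rule prime_mset_prod_add)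
  have "ideal_mset_prod R M = ideal_mset_prod R N'"
    using prime_ideal_prod_cancel[OF P] ideal_prime_mset_prod[OF M]
      ideal_prime_mset_prod[OF N'p] add.prems(3) eqM eqN by (intro equalityI) auto
  then show ?case using add.IH[OF M N'p] N' by simp
qed

lemma ideal_prod_nonzero:
  assumes "ideal I R" "ideal J R" "I \<noteq> {\<zero>}" "J \<noteq> {\<zero>}"
  shows "I \<cdot> J \<noteq> {\<zero>}"
proof -
  obtain x y where xy: "x \<in> I" "x \<noteq> \<zero>" "y \<in> J" "y \<noteq> \<zero>"
    using assms additive_subgroup.zero_closed[OF ideal.axioms(1)] by blast
  then have "x \<otimes> y \<noteq> \<zero>" using integral ideal.Icarr assms by metis
  then show ?thesis using ideal_prod.prod[OF xy(1,3), of R] by auto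
qed

lemma ideal_mset_prod_nonzero:
  assumes "prime_mset M"
  shows "ideal_mset_prod R M \<noteq> {\<zero>}"
  using assms
proof (induction M)
  case empty
  then show ?case using one_not_zero one_closed by (auto simp: ideal_mset_prod_empty simp del: one_closed)
next
  case (add P M)
  have P: "primeideal P R" "P \<noteq> {\<zero>}" and M: "prime_mset M" using add.prems by (auto simp: prime_mset_def)
  have Pid: "ideal P R" using P(1) by (rule primeideal.axioms(1))
  show ?case
    using prime_mset_prod_add[OF M Pid]
      ideal_prod_nonzero[OF Pid ideal_prime_mset_prod[OF M] P(2) add.IH[OF M]] by simp
qed

text \<open>Equality would read P R \<subseteq> P P, and cancelling P would give R \<subseteq>
  P.\<close>

lemma prime_ideal_neq_square:
  assumes P: "primeideal P R" "P \<noteq> {\<zero>}"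
  shows "\<exists>q\<in>P. q \<notin> P \<cdot> P"
proof (rule ccontr)
  interpret P: primeideal P R by fact
  assume "\<not> ?thesis"
  then have "P \<cdot> carrier R \<subseteq> P \<cdot> P" using ideal_prod_one[OF P.is_ideal] by auto
  then have "carrier R \<subseteq> P" by (rule prime_ideal_prod_cancel[OF P oneideal P.is_ideal])
  then show False using P.I_notcarr P.Icarr by blast
qed

text \<open>Multiplication by y raises the order at P by exactly one. Some j in J satisfies j y = a
  i with i outside P, so y z in P^(k+1) would give i z in P^k, where i can be cancelled.\<close>

lemma uniformizer_mult_notin_pow:
  assumes P: "primeideal P R" "P \<noteq> {\<zero>}" and y: "y \<in> P" "y \<notin> P \<cdot> P"
    and z: "z \<in> carrier R" "z \<notin> ideal_pow R P k"
  shows "y \<otimes> z \<notin> ideal_pow R P (Suc k)"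
proof
  assume yz: "y \<otimes> z \<in> ideal_pow R P (Suc k)"
  interpret P: primeideal P R by fact
  obtain a b J where a: "a \<in> carrier R" "a \<noteq> \<zero>" and J: "ideal J R" "P \<cdot> J = PIdl a"
    using prime_ideal_inverse[OF P] by metis
  interpret J: ideal J R by fact
  have yc: "y \<in> carrier R" using y(1) by (rule P.Icarr)
  note inv = ideal_inverse_prod[OF P.is_ideal J a(1)]
  have PP: "ideal (P \<cdot> P) R" by (rule ideal_prod_is_ideal[OF P.is_ideal P.is_ideal])
  have yJ: "j \<otimes> y \<in> PIdl a" if "j \<in> J" for j
    using ideal_prod.prod[OF that y(1), of R] J(2) ideal_prod_commute[OF J(1) P.is_ideal] by simp
  \<comment> \<open>Otherwise J (y) \<subseteq> a P = J P^2, and multiplying by P and cancelling a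
    would put y into P^2.\<close>
  have "\<exists>j\<in>J. \<exists>i\<in>carrier R. i \<notin> P \<and> j \<otimes> y = a \<otimes> i"
  proof (rule ccontr)
    assume no: "\<not> ?thesis"
    have "J \<cdot> (PIdl y) \<subseteq> J \<cdot> (P \<cdot> P)"
      unfolding inv(2)[OF P.is_ideal]
    proof
      fix s assume s: "s \<in> J \<cdot> (PIdl y)"
      then have "s \<in> (\<otimes>) y ` J"
        using PIdl_ideal_prod[OF yc J(1)] ideal_prod_commute[OF J(1) cgenideal_ideal[OF yc]] by simp
      then obtain j where j: "j \<in> J" "s = j \<otimes> y" using yc J.Icarr m_comm by auto
      obtain i where i: "i \<in> carrier R" "j \<otimes> y = a \<otimes> i"
        using yJ[OF j(1)] a(1) m_comm unfolding cgenideal_def by auto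
      then show "s \<in> (\<otimes>) a ` P" using no j by blast
    qed
    then have "P \<cdot> (J \<cdot> (PIdl y)) \<subseteq> P \<cdot> (J \<cdot> (P \<cdot> P))" by (rule ideal_prod_mono[OF order_refl])
    then have "(\<otimes>) a ` (PIdl y) \<subseteq> (\<otimes>) a ` (P \<cdot> P)"
      using inv(1)[OF cgenideal_ideal[OF yc]] inv(1)[OF PP] by simp
    then have "PIdl y \<subseteq> P \<cdot> P"
      by (rule mult_image_subset_cancel[OF a]) (use ideal.Icarr[OF cgenideal_ideal[OF yc]] ideal.Icarr[OF PP] in blast)+
    then show False using cgenideal_self[OF yc] y(2) by blast
  qed
  then obtain j i where ji: "j \<in> J" "i \<in> carrier R" "i \<notin> P" "j \<otimes> y = a \<otimes> i" by blast
  have Pk: "ideal (ideal_pow R P k) R" by (rule ideal_ideal_pow[OF P.is_ideal])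
  have "j \<otimes> (y \<otimes> z) \<in> J \<cdot> ideal_pow R P (Suc k)" using ji(1) yz by (rule ideal_prod.prod)
  also have "ideal_pow R P (Suc k) = P \<cdot> ideal_pow R P k"
    using ideal_pow_Suc ideal_prod_commute[OF Pk P.is_ideal] by simp
  also have "J \<cdot> \<dots> = (\<otimes>) a ` ideal_pow R P k" by (rule inv(2)[OF Pk])
  finally obtain t where t: "t \<in> ideal_pow R P k" "j \<otimes> (y \<otimes> z) = a \<otimes> t" by blast
  have "a \<otimes> (i \<otimes> z) = (j \<otimes> y) \<otimes> z" unfolding ji(4) using a ji z by (simp add: m_assoc)
  also have "\<dots> = a \<otimes> t" unfolding t(2)[symmetric] using yc z J.Icarr[OF ji(1)] by (simp add: m_assoc)
  finally have "i \<otimes> z = t" using a ji(2) z ideal.Icarr[OF Pk t(1)] m_lcancel by (metis m_closed)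
  then have "z \<in> ideal_pow R P k"
    using maximalideal_pow_cancel[OF nonzero_prime_maximal[OF P] ji(2,3) z(1)] t(1) by blast
  then show False using z(2) by blast
qed

end

section \<open>Quotient rings\<close>

text \<open>For a factorization \<open>M\<close> this is Omega - omega, written as the number of
  terms adjoined in the lower bound; every exponent is at least 1, so nothing truncates.\<close>

lemma size_diff_card_set_mset:
  "(\<Sum>x\<in>set_mset M. count M x - 1) = size M - card (set_mset M)"
proof -
  have "(\<Sum>x\<in>set_mset M. count M x - 1) = (\<Sum>x\<in>set_mset M. count M x) - (\<Sum>x\<in>set_mset M. 1)"
    by (rule sum_subtractf_nat) (simp add: Suc_le_eq)
  then show ?thesis by (simp add: size_multiset_overloaded_eq)
qed

context cring
begin

lemma carrier_Quot: "carrier (R Quot A) = (\<lambda>x. A +> x) ` carrier R"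
  by (auto simp: FactRing_def A_RCOSETS_def')

lemma zero_Quot: "\<zero>\<^bsub>R Quot A\<^esub> = A"
  by (simp add: FactRing_def)

lemma Quot_eqI:
  assumes "ideal A R" "x \<in> carrier R" "y \<in> carrier R" "x \<ominus> y \<in> A"
  shows "A +> x = A +> y"
  using assms quotient_eq_iff_same_a_r_cos by blast

lemma Quot_eqD:
  assumes "ideal A R" "x \<in> carrier R" "y \<in> carrier R" "A +> x = A +> y"
  shows "x \<ominus> y \<in> A"
  using assms quotient_eq_iff_same_a_r_cos by blast

lemma Quot_unitI:
  assumes A: "ideal A R" and w: "w \<in> carrier R" and r: "r \<in> carrier R" "p \<in> A" "r \<otimes> w \<oplus> p = \<one>"
  shows "A +> w \<in> Units (R Quot A)"
proof -
  interpret h: ring_hom_cring R "R Quot A" "(+>) A" by (rule ideal.rcos_ring_hom_cring[OF A is_cring])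
  have p: "p \<in> carrier R" using ideal.Icarr[OF A r(2)] .
  have "\<one> \<ominus> r \<otimes> w = p" unfolding r(3)[symmetric] using r(1) w p by algebra
  then have "A +> \<one> = A +> (w \<otimes> r)" using r w by (intro Quot_eqI[OF A]) (auto simp: m_comm)
  then have "(A +> w) \<otimes>\<^bsub>R Quot A\<^esub> (A +> r) = \<one>\<^bsub>R Quot A\<^esub>" using r w by simp
  then show ?thesis
    using r(1) w by (intro h.S.UnitsI[of _ "A +> r"]) simp_all
qed

lemma Quot_unitD:
  assumes A: "ideal A R" and P: "primeideal P R" "A \<subseteq> P" and w: "w \<in> carrier R" "A +> w \<in> Units (R Quot A)"
  shows "w \<notin> P"
proof
  interpret h: ring_hom_cring R "R Quot A" "(+>) A" by (rule ideal.rcos_ring_hom_cring[OF A is_cring])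
  interpret P: primeideal P R by fact
  assume wP: "w \<in> P"
  obtain v where v: "v \<in> carrier (R Quot A)" "v \<otimes>\<^bsub>R Quot A\<^esub> (A +> w) = \<one>\<^bsub>R Quot A\<^esub>"
    using w(2) by (auto simp: Units_def)
  then obtain r where r: "r \<in> carrier R" "v = A +> r" by (auto simp: carrier_Quot)
  have "A +> \<one> = A +> (r \<otimes> w)" using v r w by simp
  then have "\<one> \<ominus> r \<otimes> w \<in> P" using Quot_eqD[OF A] r w P(2) by blast
  moreover have "r \<otimes> w \<in> P" using wP r(1) by (rule P.I_l_closed)
  moreover have "\<one> = (\<one> \<ominus> r \<otimes> w) \<oplus> r \<otimes> w" using r w by algebra
  ultimately have "\<one> \<in> P" using P.a_closed by metis
  then show False using P.one_imp_carrier P.I_notcarr by blast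
qed

lemma primeideal_nat_pow:
  assumes P: "primeideal P R" and "x \<in> carrier R" "x [^] (n::nat) \<in> P"
  shows "x \<in> P"
  using assms(3)
proof (induction n)
  case 0
  then show ?case
    using ideal.one_imp_carrier[OF primeideal.axioms(1)[OF P]] primeideal.I_notcarr[OF P] by auto
next
  case (Suc n)
  then show ?case using primeideal.I_prime[OF P, of "x [^] n" x] assms(2) by auto
qed

lemma idempotent_unit_factorization:
  assumes a: "a \<in> carrier R" and m: "m > (0::nat)"
    and idem: "a [^] m \<otimes> a [^] m = a [^] m" and absorb: "a \<otimes> a [^] m = a"
  shows "\<exists>e\<in>carrier R. \<exists>u\<in>Units R. e \<otimes> e = e \<and> a = e \<otimes> u"
proof -
  define e where "e = a [^] m"
  \<comment> \<open>\<open>b\<close> is the inverse of \<open>a\<close> in the ring e R with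
    identity e. Since \<open>u\<close> acts as \<open>a\<close> on e R and as 1 on (1 - e) R, its
    inverse is b + 1 - e.\<close>
  define b where "b = a [^] (m - 1) \<otimes> e"
  define u where "u = a \<oplus> \<one> \<ominus> e"
  have c: "e \<in> carrier R" "b \<in> carrier R" "u \<in> carrier R" using a by (auto simp: e_def b_def u_def)
  have ee: "e \<otimes> e = e" and ae: "a \<otimes> e = a" using idem absorb by (simp_all add: e_def)
  have be: "b \<otimes> e = b" using ee c a by (simp add: b_def m_assoc)
  have "a \<otimes> b = (a [^] (m - 1) \<otimes> a) \<otimes> e" using a c by (simp add: b_def m_ac)
  also have "a [^] (m - 1) \<otimes> a = e" using m nat_pow_Suc[of a "m - 1"] by (simp add: e_def)
  finally have ab: "a \<otimes> b = e" using ee by simp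
  have "u \<otimes> (b \<oplus> \<one> \<ominus> e) = a \<otimes> b \<oplus> a \<ominus> a \<otimes> e \<oplus> b \<oplus> \<one> \<ominus> e \<ominus> b \<otimes> e \<ominus> e \<oplus> e \<otimes> e"
    unfolding u_def using a c(1,2) by algebra
  also have "\<dots> = \<one>" unfolding ab ae be ee using a c(1,2) by algebra
  finally have "u \<otimes> (b \<oplus> \<one> \<ominus> e) = \<one>" .
  moreover have "b \<oplus> \<one> \<ominus> e \<in> carrier R" using c by simp
  ultimately have "u \<in> Units R" using c(3) UnitsI by blast
  moreover have "e \<otimes> u = a \<otimes> e \<oplus> e \<ominus> e \<otimes> e" unfolding u_def using a c(1) by algebra
  then have "e \<otimes> u = a" unfolding ae ee using a c(1) by algebra
  ultimately show ?thesis using c(1) ee by metis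
qed

text \<open>Modulo a prime, an idempotent power a^m is 0 or 1, and in both cases a a^m = a. As the
  primes in \<open>S\<close> intersect in A, this holds in R/A as well. The empty \<open>S\<close>
  covers the zero ring, and \<open>S\<close> consisting of (0) covers the zero ideal.\<close>

lemma I_r_Quot_radical:
  assumes A: "ideal A R" and fin: "finite (carrier (R Quot A))"
    and S: "\<And>P. P \<in> S \<Longrightarrow> primeideal P R \<and> A \<subseteq> P"
    and rad: "\<And>x. x \<in> carrier R \<Longrightarrow> (\<And>P. P \<in> S \<Longrightarrow> x \<in> P) \<Longrightarrow> x \<in> A"
  shows "I_r (R Quot A) = I_r (units_of (R Quot A))"
proof -
  interpret h: ring_hom_cring R "R Quot A" "(+>) A" by (rule ideal.rcos_ring_hom_cring[OF A is_cring])
  show ?thesis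
  proof (rule h.S.I_r_eq_units_of[OF fin])
    fix a assume a: "a \<in> carrier (R Quot A)"
    then obtain r where r: "r \<in> carrier R" "a = A +> r" by (auto simp: carrier_Quot)
    obtain m :: nat where m: "m > 0" "a [^]\<^bsub>R Quot A\<^esub> m \<otimes>\<^bsub>R Quot A\<^esub> a [^]\<^bsub>R Quot A\<^esub> m = a [^]\<^bsub>R Quot A\<^esub> m"
      using h.S.exists_idempotent_power[OF fin a] by blast
    have am: "a [^]\<^bsub>R Quot A\<^esub> m = A +> (r [^] m)" using r by (simp add: h.hom_pow)
    then have "A +> (r [^] m \<otimes> r [^] m) = A +> (r [^] m)" using m(2) r by simp
    then have rA: "r [^] m \<otimes> r [^] m \<ominus> r [^] m \<in> A" using r by (intro Quot_eqD[OF A]) auto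
    have "r \<otimes> r [^] m \<ominus> r \<in> A"
    proof (rule rad)
      fix P assume "P \<in> S"
      then have P: "primeideal P R" "A \<subseteq> P" using S by auto
      interpret P: primeideal P R by fact
      have "s \<otimes> (s \<ominus> \<one>) = s \<otimes> s \<ominus> s" if "s \<in> carrier R" for s using that by algebra
      then have "r [^] m \<otimes> (r [^] m \<ominus> \<one>) = r [^] m \<otimes> r [^] m \<ominus> r [^] m" using r by simp
      then have "r [^] m \<otimes> (r [^] m \<ominus> \<one>) \<in> P" using rA P(2) by auto
      then have "r [^] m \<in> P \<or> r [^] m \<ominus> \<one> \<in> P" using r by (intro P.I_prime) auto
      then have "r \<otimes> (r [^] m \<ominus> \<one>) \<in> P"
        using primeideal_nat_pow[OF P(1) r(1)] r(1) P.I_l_closed P.I_r_closed by (meson minus_closed nat_pow_closed one_closed)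
      moreover have "r \<otimes> s \<ominus> r = r \<otimes> (s \<ominus> \<one>)" if "s \<in> carrier R" for s using that r(1) by algebra
      then have "r \<otimes> r [^] m \<ominus> r = r \<otimes> (r [^] m \<ominus> \<one>)" using r by simp
      ultimately show "r \<otimes> r [^] m \<ominus> r \<in> P" by simp
    qed (use r in simp)
    then have "A +> (r \<otimes> r [^] m) = A +> r" using r by (intro Quot_eqI[OF A]) auto
    then have "a \<otimes>\<^bsub>R Quot A\<^esub> a [^]\<^bsub>R Quot A\<^esub> m = a" using am r by simp
    then show "\<exists>e\<in>carrier (R Quot A). \<exists>u\<in>Units (R Quot A). e \<otimes>\<^bsub>R Quot A\<^esub> e = e \<and> a = e \<otimes>\<^bsub>R Quot A\<^esub> u"
      by (rule h.S.idempotent_unit_factorization[OF a m])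
  qed
qed

lemma finprod_in_ideal_pow:
  assumes P: "ideal P R" and "finite J" "x \<in> J \<rightarrow> P"
  shows "finprod R x J \<in> ideal_pow R P (card J)"
  using assms(2,3)
proof (induction J)
  case empty
  then show ?case by (simp add: ideal_pow_0)
next
  case (insert j J)
  have "x \<in> J \<rightarrow> carrier R" "x j \<in> carrier R" using insert.prems ideal.Icarr[OF P] by auto
  then have "finprod R x (insert j J) = finprod R x J \<otimes> x j"
    using insert.hyps by (simp add: m_comm)
  also have "\<dots> \<in> ideal_pow R P (card J) \<cdot> P"
    using insert by (intro ideal_prod.prod) auto
  finally show ?case using insert.hyps by (simp add: ideal_pow_Suc)
qed

lemma I_r_Quot_maximal_pow_le:
  assumes P: "maximalideal P R" and "n > 0" and fin: "finite (carrier (R Quot (ideal_pow R P n)))"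
  shows "I_r (R Quot (ideal_pow R P n)) \<le> I_r (units_of (R Quot (ideal_pow R P n))) + n - 1"
proof -
  define A where "A = ideal_pow R P n"
  have A: "ideal A R" unfolding A_def by (rule ideal_ideal_pow[OF maximalideal.axioms(1)[OF P]])
  interpret h: ring_hom_cring R "R Quot A" "(+>) A" by (rule ideal.rcos_ring_hom_cring[OF A is_cring])
  have "I_r (R Quot A) \<le> I_r (units_of (R Quot A)) + n - 1"
  proof (rule h.S.I_r_le_of_nilpotent_nonunits[OF fin[folded A_def] \<open>n > 0\<close>])
    fix J :: "nat set" and x
    assume J: "finite J" "card J = n" and x: "x \<in> J \<rightarrow> carrier (R Quot A) - Units (R Quot A)"
    have "\<forall>j\<in>J. \<exists>r\<in>carrier R. x j = A +> r" using x by (auto simp: carrier_Quot Pi_iff)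
    then obtain r where r: "\<And>j. j \<in> J \<Longrightarrow> r j \<in> carrier R" "\<And>j. j \<in> J \<Longrightarrow> x j = A +> r j" by metis
    \<comment> \<open>An element outside P is invertible modulo every power of P, so a nonunit has
      all its representatives in P.\<close>
    have rP: "r j \<in> P" if j: "j \<in> J" for j
    proof (rule ccontr)
      assume "r j \<notin> P"
      then obtain s p where "s \<in> carrier R" "p \<in> A" "s \<otimes> r j \<oplus> p = \<one>"
        using maximalideal_pow_comaximal[OF P r(1)[OF j]] unfolding A_def by metis
      then have "x j \<in> Units (R Quot A)" using Quot_unitI[OF A r(1)[OF j]] r(2)[OF j] by simp
      then show False using x j by auto
    qed
    have "finprod R r J \<in> A"
      using finprod_in_ideal_pow[OF maximalideal.axioms(1)[OF P] J(1), of r] rP J(2) by (simp add: A_def)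
    then have "A +> finprod R r J = \<zero>\<^bsub>R Quot A\<^esub>" unfolding zero_Quot by (rule a_rcos_zero[OF A])
    moreover have rc: "r \<in> J \<rightarrow> carrier R" using r(1) by blast
    have "A +> finprod R r J = (\<Otimes>\<^bsub>R Quot A\<^esub>j\<in>J. ((+>) A \<circ> r) j)" by (rule h.hom_finprod[OF rc])
    moreover have "\<dots> = (\<Otimes>\<^bsub>R Quot A\<^esub>j\<in>J. x j)"
      using r(2) rc by (intro h.S.finprod_cong') (auto simp: Pi_iff carrier_Quot)
    ultimately show "(\<Otimes>\<^bsub>R Quot A\<^esub>j\<in>J. x j) = \<zero>\<^bsub>R Quot A\<^esub>" by simp
  qed
  then show ?thesis by (simp add: A_def)
qed

end

context dedekind_domain
begin

section \<open>The lower bound\<close>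

text \<open>Factors indexed by \<open>B\<close> have order one at P and the others order zero, so
  the order of the product is at most the number of indices in \<open>B\<close>.\<close>

lemma finprod_notin_ideal_pow:
  assumes P: "primeideal P R" "P \<noteq> {\<zero>}" and "finite J" "w \<in> J \<rightarrow> carrier R"
    and B: "\<And>j. j \<in> J \<Longrightarrow> j \<in> B \<Longrightarrow> w j \<in> P \<and> w j \<notin> P \<cdot> P"
    and notB: "\<And>j. j \<in> J \<Longrightarrow> j \<notin> B \<Longrightarrow> w j \<notin> P"
  shows "finprod R w J \<notin> ideal_pow R P (Suc (card (J \<inter> B)))"
  using assms(3-)
proof (induction J)
  case empty
  interpret P: primeideal P R by (rule P)
  have "\<one> \<notin> P" using P.one_imp_carrier P.I_notcarr by blast
  then show ?case using ideal_pow_1[OF P.is_ideal] by simp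
next
  case (insert j J)
  have w: "w \<in> J \<rightarrow> carrier R" "w j \<in> carrier R" using insert.prems by auto
  have IH: "finprod R w J \<notin> ideal_pow R P (Suc (card (J \<inter> B)))"
    using insert.IH w insert.prems by blast
  have eq: "finprod R w (insert j J) = w j \<otimes> finprod R w J" using insert.hyps w by simp
  have z: "finprod R w J \<in> carrier R" using w by simp
  show ?case
  proof (cases "j \<in> B")
    case True
    have "w j \<otimes> finprod R w J \<notin> ideal_pow R P (Suc (Suc (card (J \<inter> B))))"
      using insert.prems(2)[of j] True by (intro uniformizer_mult_notin_pow[OF P _ _ z IH]) auto
    then show ?thesis using True insert.hyps eq by simp
  next
    case False
    then have "w j \<notin> P" using insert.prems(3)[of j] by simp
    then have "finprod R w (insert j J) \<notin> ideal_pow R P (Suc (card (J \<inter> B)))"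
      using maximalideal_pow_cancel[OF nonzero_prime_maximal[OF P] w(2) _ z] IH unfolding eq by blast
    moreover have "insert j J \<inter> B = J \<inter> B" using False by blast
    ultimately show ?thesis by argo
  qed
qed

lemma I_r_Quot_ge:
  assumes M: "prime_mset M" and A: "A = ideal_mset_prod R M" and fin: "finite (carrier (R Quot A))"
  shows "I_r (units_of (R Quot A)) + (size M - card (set_mset M)) \<le> I_r (R Quot A)"
proof (rule ccontr)
  have Aid: "ideal A R" unfolding A by (rule ideal_prime_mset_prod[OF M])
  interpret h: ring_hom_cring R "R Quot A" "(+>) A" by (rule ideal.rcos_ring_hom_cring[OF Aid is_cring])
  interpret U: comm_group "units_of (R Quot A)" by (rule h.S.units_comm_group)
  interpret A: ideal A R by (rule Aid)
  define D where "D = I_r (units_of (R Quot A))"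
  have "finite (carrier (units_of (R Quot A)))"
    using fin finite_subset[of "Units (R Quot A)" "carrier (R Quot A)"] by (auto simp: units_of_carrier)
  then have D: "D > 0" unfolding D_def by (rule U.I_r_pos)
  assume "\<not> I_r (units_of (R Quot A)) + (size M - card (set_mset M)) \<le> I_r (R Quot A)"
  then have small: "I_r (R Quot A) \<le> (D - 1) + (size M - card (set_mset M))" using D by (simp add: D_def)
  obtain x where x: "x \<in> {..<D - 1} \<rightarrow> carrier (units_of (R Quot A))"
    "\<not> has_idempotent_subproduct (units_of (R Quot A)) x {..<D - 1}"
    using U.exists_no_idempotent_subproduct[of "D - 1"] D by (auto simp: D_def)
  have xU: "x \<in> {..<D - 1} \<rightarrow> Units (R Quot A)" using x(1) by (simp add: units_of_carrier)
  have xno: "\<not> has_idempotent_subproduct (R Quot A) x {..<D - 1}"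
    using x(2) h.S.has_idempotent_subproduct_units_of[OF _ xU] by simp
  have "\<forall>j\<in>{..<D - 1}. \<exists>r\<in>carrier R. x j = A +> r" using xU h.S.Units_closed by (fastforce simp: carrier_Quot)
  then obtain u where u: "\<And>j. j < D - 1 \<Longrightarrow> u j \<in> carrier R" "\<And>j. j < D - 1 \<Longrightarrow> x j = A +> u j"
    by (metis lessThan_iff)
  have "\<exists>y. y \<in> P \<and> y \<notin> P \<cdot> P \<and> (\<forall>Q\<in>#M. Q \<noteq> P \<longrightarrow> y \<notin> Q)" if P: "P \<in># M" for P
  proof -
    have Pp: "primeideal P R" "P \<noteq> {\<zero>}" using M P by (auto simp: prime_mset_def)
    obtain q where q: "q \<in> P" "q \<notin> P \<cdot> P" using prime_ideal_neq_square[OF Pp] by blast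
    have N: "primeideal Q R \<and> \<not> Q \<subseteq> P" if "Q \<in># filter_mset (\<lambda>Q. Q \<noteq> P) M" for Q
    proof -
      from that have Q: "Q \<in># M" "Q \<noteq> P" by auto
      then have "\<not> Q \<subseteq> P"
        using maximalideal_eqI[OF prime_mset_maximal[OF M Q(1)] prime_mset_maximal[OF M P]] by blast
      then show ?thesis using M Q(1) by (simp add: prime_mset_def)
    qed
    obtain y where "y \<in> P" "y \<notin> P \<cdot> P" "\<And>Q. Q \<in># filter_mset (\<lambda>Q. Q \<noteq> P) M \<Longrightarrow> y \<notin> Q"
      using exists_uniformizer[OF nonzero_prime_maximal[OF Pp] q N] by blast
    then show ?thesis by auto
  qed
  then obtain y where y: "\<And>P. P \<in># M \<Longrightarrow> y P \<in> P" "\<And>P. P \<in># M \<Longrightarrow> y P \<notin> P \<cdot> P"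
    "\<And>P Q. P \<in># M \<Longrightarrow> Q \<in># M \<Longrightarrow> Q \<noteq> P \<Longrightarrow> y P \<notin> Q"
    by metis
  \<comment> \<open>The sequence is lifted to R, where orders at P make sense: \<open>Inl\<close>
    indexes representatives of the extremal units, and \<open>Inr (P, k)\<close> the copy number k
    of \<open>y P\<close>.\<close>
  define w where "w = case_sum u (\<lambda>(P, k::nat). y P)"
  define K where "K = {..<D - 1} <+> (SIGMA P:set_mset M. {..<count M P - 1})"
  have finK: "finite K" by (simp add: K_def finite_Plus)
  have "card K = (D - 1) + (size M - card (set_mset M))"
    by (simp add: K_def card_Plus card_SigmaI size_diff_card_set_mset[symmetric])
  have wc: "w \<in> K \<rightarrow> carrier R"
    using u(1) y(1) ideal.Icarr[OF prime_mset_ideal[OF M]] by (auto simp: K_def w_def)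
  have "has_idempotent_subproduct (R Quot A) ((+>) A \<circ> w) K"
    using small \<open>card K = _\<close> wc by (intro h.S.has_idempotent_subproduct_I_r[OF fin finK]) (auto simp: Pi_iff)
  then obtain J where J: "J \<subseteq> K" "J \<noteq> {}" and idem:
    "finprod (R Quot A) ((+>) A \<circ> w) J \<otimes>\<^bsub>R Quot A\<^esub> finprod (R Quot A) ((+>) A \<circ> w) J = finprod (R Quot A) ((+>) A \<circ> w) J"
    unfolding has_idempotent_subproduct_def by blast
  have finJ: "finite J" using J(1) finK by (rule finite_subset)
  have wJ: "w \<in> J \<rightarrow> carrier R" using wc J(1) by blast
  define z where "z = finprod R w J"
  have z: "z \<in> carrier R" unfolding z_def by (rule finprod_closed[OF wJ])
  have hz: "A +> z = finprod (R Quot A) ((+>) A \<circ> w) J" unfolding z_def by (rule h.hom_finprod[OF wJ])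
  have "A +> (z \<otimes> z) = A +> z" using idem z by (simp add: hz[symmetric])
  then have zA: "z \<otimes> z \<ominus> z \<in> A" using z by (intro Quot_eqD[OF Aid]) auto
  have no: "Inr (P, k) \<notin> J" for P k
  proof
    assume Pk: "Inr (P, k) \<in> J"
    then have P: "P \<in># M" and e: "count M P > 0" using J(1) by (auto simp: K_def)
    have Pp: "primeideal P R" "P \<noteq> {\<zero>}" using M P by (auto simp: prime_mset_def)
    interpret P: primeideal P R by (rule Pp)
    \<comment> \<open>\<open>B\<close> marks the copies of \<open>y P\<close>, of which at most e -
      1 exist. All other terms, namely representatives of units and the elements for other primes,
      lie outside P.\<close>
    define B :: "(nat + 'a set \<times> nat) set" where "B = Inr ` ({P} \<times> UNIV)"
    have "J \<inter> B \<subseteq> Inr ` ({P} \<times> {..<count M P - 1})" using J(1) by (auto simp: K_def B_def)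
    then have "card (J \<inter> B) \<le> card (Inr ` ({P} \<times> {..<count M P - 1}) :: (nat + 'a set \<times> nat) set)"
      by (intro card_mono) auto
    also have "\<dots> = count M P - 1" by (subst card_image) (auto simp: card_cartesian_product)
    finally have cardB: "Suc (card (J \<inter> B)) \<le> count M P" using e by linarith
    have AP: "A \<subseteq> P" unfolding A by (rule prime_mset_prod_subset[OF M P])
    have "finprod R w J \<notin> ideal_pow R P (Suc (card (J \<inter> B)))"
    proof (rule finprod_notin_ideal_pow[OF Pp finJ wJ])
      fix j assume j: "j \<in> J"
      show "w j \<in> P \<and> w j \<notin> P \<cdot> P" if "j \<in> B" using that y(1,2) P by (auto simp: B_def w_def)
      show "w j \<notin> P" if jB: "j \<notin> B"
      proof (cases j)
        case (Inl i)
        then have i: "i < D - 1" using j J(1) by (auto simp: K_def)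
        have "A +> u i \<in> Units (R Quot A)" using xU u(2)[OF i] i by (metis PiE lessThan_iff)
        then show ?thesis using Quot_unitD[OF Aid Pp(1) AP u(1)[OF i]] by (simp add: w_def Inl)
      next
        case (Inr Ql)
        obtain Q l where Ql: "Ql = (Q, l)" by fastforce
        then have "Q \<in># M" "P \<noteq> Q" using j J(1) Inr jB by (auto simp: K_def B_def)
        then show ?thesis using y(3)[of Q P] P by (simp add: w_def Inr Ql)
      qed
    qed
    then have zP: "z \<notin> ideal_pow R P (count M P)"
      using ideal_pow_antimono[OF P.is_ideal cardB] by (auto simp: z_def)
    have "z = w (Inr (P, k)) \<otimes> finprod R w (J - {Inr (P, k)})"
    proof -
      have "J = insert (Inr (P, k)) (J - {Inr (P, k)})" using Pk by blast
      then have "z = finprod R w (insert (Inr (P, k)) (J - {Inr (P, k)}))" by (simp add: z_def)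
      also have "\<dots> = w (Inr (P, k)) \<otimes> finprod R w (J - {Inr (P, k)})"
        using wJ Pk finJ by (intro finprod_insert) auto
      finally show ?thesis .
    qed
    moreover have "finprod R w (J - {Inr (P, k)}) \<in> carrier R" using wJ by (intro finprod_closed) auto
    ultimately have "z \<in> P" using y(1)[OF P] by (auto simp: w_def intro: P.I_r_closed)
    have "z \<ominus> \<one> \<notin> P"
    proof
      assume "z \<ominus> \<one> \<in> P"
      then have "z \<oplus> \<ominus> (z \<ominus> \<one>) \<in> P" using \<open>z \<in> P\<close> by (intro P.a_closed P.a_inv_closed)
      moreover have "z \<oplus> \<ominus> (z \<ominus> \<one>) = \<one>" using z by algebra
      ultimately have "\<one> \<in> P" by simp
      then show False using P.one_imp_carrier P.I_notcarr by blast
    qed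
    have "A \<subseteq> ideal_pow R P (count M P)"
      unfolding A using ideal_mset_prod_subset_pow[OF _ P] prime_mset_ideal[OF M] by blast
    moreover have "(z \<ominus> \<one>) \<otimes> z = z \<otimes> z \<ominus> z" using z by algebra
    ultimately have "(z \<ominus> \<one>) \<otimes> z \<in> ideal_pow R P (count M P)" using zA by (simp only: subsetD)
    \<comment> \<open>As z - 1 is outside P, it can be cancelled modulo P^e.\<close>
    then have "z \<in> ideal_pow R P (count M P)"
      by (rule maximalideal_pow_cancel[OF nonzero_prime_maximal[OF Pp] minus_closed[OF z one_closed] \<open>z \<ominus> \<one> \<notin> P\<close> z])
    then show False using zP by blast
  qed
  \<comment> \<open>Only unit terms remain, so the idempotent product comes from a subsequence of
    the extremal sequence \<open>x\<close>, against its choice.\<close>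
  define J' where "J' = {i. Inl i \<in> J}"
  have JJ': "J = Inl ` J'"
  proof (intro equalityI subsetI)
    fix j assume j: "j \<in> J"
    then show "j \<in> Inl ` J'" using no by (cases j) (auto simp: J'_def)
  qed (auto simp: J'_def)
  then have J': "J' \<subseteq> {..<D - 1}" "J' \<noteq> {}" using J by (auto simp: K_def)
  have "finprod (R Quot A) ((+>) A \<circ> w) J = (\<Otimes>\<^bsub>R Quot A\<^esub>i\<in>J'. ((+>) A \<circ> w) (Inl i))"
    unfolding JJ' using wJ JJ' by (intro h.S.finprod_reindex) (auto simp: Pi_iff)
  also have "\<dots> = (\<Otimes>\<^bsub>R Quot A\<^esub>i\<in>J'. x i)"
  proof (rule h.S.finprod_cong')
    show "x \<in> J' \<rightarrow> carrier (R Quot A)" using xU J'(1) h.S.Units_closed by (auto simp: Pi_iff subset_iff)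
    show "((+>) A \<circ> w) (Inl i) = x i" if "i \<in> J'" for i using that J'(1) u(2) by (auto simp: w_def)
  qed simp
  finally have "finprod (R Quot A) ((+>) A \<circ> w) J = (\<Otimes>\<^bsub>R Quot A\<^esub>i\<in>J'. x i)" .
  then have "has_idempotent_subproduct (R Quot A) x {..<D - 1}"
    unfolding has_idempotent_subproduct_def using idem J' by (intro exI[of _ J']) simp
  then show False using xno by blast
qed

section \<open>Evaluation of the factorization multiset\<close>

text \<open>For \<open>THE\<close>, competitors containing the zero ideal must also be excluded:
  their product is zero, whereas a product of nonzero primes in a domain is not.\<close>

lemma prime_ideal_factorization_eqI:
  assumes "prime_mset M" "A = ideal_mset_prod R M"
  shows "prime_ideal_factorization R A = M"
  unfolding prime_ideal_factorization_def
proof (rule the_equality)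
  show "is_prime_ideal_factorization R A M"
    using assms unfolding is_prime_ideal_factorization_def ideal_mset_prod_def
    by (auto simp: prime_mset_def)
next
  fix N assume N: "is_prime_ideal_factorization R A N"
  have AN: "A = ideal_mset_prod R N" and pr: "\<And>P. P \<in># N \<Longrightarrow> primeideal P R"
    and zero: "{\<zero>} \<in># N \<Longrightarrow> N = {#{\<zero>}#}"
    using N unfolding is_prime_ideal_factorization_def ideal_mset_prod_def by auto
  have "{\<zero>} \<notin># N"
  proof
    assume "{\<zero>} \<in># N"
    then have "ideal_mset_prod R N \<subseteq> {\<zero>}"
      using pr by (intro ideal_mset_prod_subset) (auto simp: primeideal.axioms(1))
    moreover have "\<zero> \<in> ideal_mset_prod R M"
      using additive_subgroup.zero_closed[OF ideal.axioms(1)[OF ideal_prime_mset_prod[OF assms(1)]]] .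
    ultimately show False using ideal_mset_prod_nonzero[OF assms(1)] AN assms(2) by blast
  qed
  then have "prime_mset N" using pr by (auto simp: prime_mset_def)
  then show "N = M" using prime_mset_unique assms AN by metis
qed

lemma prime_ideal_factorization_zero: "prime_ideal_factorization R {\<zero>} = {#{\<zero>}#}"
  unfolding prime_ideal_factorization_def
proof (rule the_equality)
  have "ideal_mset_prod R {#{\<zero>}#} = {\<zero>}"
    using ideal_mset_prod_add[of "{#}" "{\<zero>}"] zeroideal by (simp add: ideal_mset_prod_empty ideal_prod_one)
  then show "is_prime_ideal_factorization R {\<zero>} {#{\<zero>}#}"
    using zeroprimeideal unfolding is_prime_ideal_factorization_def ideal_mset_prod_def by simp
next
  fix N assume N: "is_prime_ideal_factorization R {\<zero>} N"
  show "N = {#{\<zero>}#}"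
  proof (cases "{\<zero>} \<in># N")
    case True
    then show ?thesis using N unfolding is_prime_ideal_factorization_def by blast
  next
    case False
    then have "prime_mset N" using N by (auto simp: is_prime_ideal_factorization_def prime_mset_def)
    then show ?thesis
      using ideal_mset_prod_nonzero N by (auto simp: is_prime_ideal_factorization_def ideal_mset_prod_def)
  qed
qed

section \<open>The two cases of equality\<close>

lemma I_r_Quot_eq_maximal_pow:
  assumes P: "primeideal P R" and A: "A = ideal_pow R P n" "A \<noteq> {\<zero>}" and fin: "finite (carrier (R Quot A))"
    and M: "prime_mset M" "A = ideal_mset_prod R M"
  shows "I_r (R Quot A) = I_r (units_of (R Quot A)) + (size M - card (set_mset M))"
proof (cases "n = 0")
  \<comment> \<open>Here A is the unit ideal and the quotient the zero ring. The nilpotency bound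
    needs a positive exponent, so A is treated as the empty intersection of primes.\<close>
  case True
  then have AR: "A = carrier R" using A(1) by (simp add: ideal_pow_0)
  then have "M = {#}"
    using prime_mset_unique[OF M(1), of "{#}"] M(2) by (simp add: prime_mset_def ideal_mset_prod_empty)
  moreover have "I_r (R Quot A) = I_r (units_of (R Quot A))"
    using fin by (intro I_r_Quot_radical[of _ "{}"]) (auto simp: AR oneideal)
  ultimately show ?thesis by simp
next
  case False
  interpret P: primeideal P R by (rule P)
  have Aid: "ideal A R" unfolding A(1) by (rule ideal_ideal_pow[OF P.is_ideal])
  have "A \<subseteq> P"
    using ideal_pow_antimono[OF P.is_ideal, of 1 n] ideal_pow_1[OF P.is_ideal] False by (simp add: A(1))
  then have P0: "P \<noteq> {\<zero>}" using A(2) additive_subgroup.zero_closed[OF ideal.axioms(1)[OF Aid]] by blast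
  have pm: "prime_mset (replicate_mset n P)" using P P0 by (auto simp: prime_mset_def)
  have "ideal_mset_prod R (replicate_mset k P) = ideal_pow R P k" for k
  proof (induction k)
    case 0
    then show ?case by (simp add: ideal_mset_prod_empty ideal_pow_0)
  next
    case (Suc k)
    have "ideal_mset_prod R (add_mset P (replicate_mset k P)) = P \<cdot> ideal_mset_prod R (replicate_mset k P)"
      using P.is_ideal by (intro ideal_mset_prod_add) (auto split: if_splits)
    then show ?case
      using Suc ideal_prod_commute[OF P.is_ideal ideal_ideal_pow[OF P.is_ideal]] by (simp add: ideal_pow_Suc)
  qed
  then have "M = replicate_mset n P" using prime_mset_unique[OF M(1) pm] M(2) A(1) by simp
  moreover have "I_r (R Quot A) \<le> I_r (units_of (R Quot A)) + n - 1"
    using I_r_Quot_maximal_pow_le[OF nonzero_prime_maximal[OF P P0], of n] False fin by (simp add: A(1))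
  ultimately show ?thesis using I_r_Quot_ge[OF M fin] False by (simp add: set_mset_replicate_mset_subset)
qed

text \<open>Since A is nonzero, all members of \<open>S\<close> are nonzero and hence maximal. Then
  A is their intersection, and unique factorization makes all multiplicities 1, so the correction
  term vanishes.\<close>

lemma I_r_Quot_eq_squarefree:
  assumes S: "finite S" "\<And>P. P \<in> S \<Longrightarrow> primeideal P R" and A: "A = (\<Otimes>\<^bsub>ideals_set R\<^esub>P\<in>S. P)" "A \<noteq> {\<zero>}"
    and fin: "finite (carrier (R Quot A))" and M: "prime_mset M" "A = ideal_mset_prod R M"
  shows "I_r (R Quot A) = I_r (units_of (R Quot A)) + (size M - card (set_mset M))"
proof -
  interpret ideals: comm_monoid "ideals_set R" by (rule ideals_set_is_comm_monoid)
  have Sid: "\<And>P. P \<in> S \<Longrightarrow> ideal P R" using S(2) by (simp add: primeideal.axioms(1))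
  have AS: "A = ideal_mset_prod R (mset_set S)"
    unfolding A(1) ideal_mset_prod_def using S(1) Sid
    by (intro ideals.finprod_cong') (auto simp: ideal_one_prod)
  have sub: "A \<subseteq> P" if "P \<in> S" for P
    unfolding AS using S(1) Sid that by (intro ideal_mset_prod_subset) auto
  have Aid: "ideal A R" unfolding M(2) by (rule ideal_prime_mset_prod[OF M(1)])
  have "P \<noteq> {\<zero>}" if "P \<in> S" for P
    using sub[OF that] A(2) additive_subgroup.zero_closed[OF ideal.axioms(1)[OF Aid]] by blast
  then have pm: "prime_mset (mset_set S)" using S by (auto simp: prime_mset_def)
  have "M = mset_set S" using prime_mset_unique[OF M(1) pm] M(2) AS by simp
  moreover have "I_r (R Quot A) = I_r (units_of (R Quot A))"
  proof (rule I_r_Quot_radical[OF Aid fin])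
    show "x \<in> A" if "x \<in> carrier R" "\<And>P. P \<in> S \<Longrightarrow> x \<in> P" for x
      unfolding AS using prime_mset_maximal[OF pm] S(1) that
      by (intro mem_prod_maximalideals) auto
  qed (use S(2) sub in blast)
  ultimately show ?thesis using S(1) by simp
qed

end

theorem theorem5p3:
  fixes R :: "('a, 'm) ring_scheme" and A :: "'a set"
  assumes "dedekind_domain R" and "ideal A R" and "finite (carrier (R Quot A))"
  shows "I_r (R Quot A) \<ge> davenport (units_of (R Quot A)) + Omega R A - omega R A \<and>
    ((\<exists>P (n::nat). primeideal P R \<and> A = P [^]\<^bsub>ideals_set R\<^esub> n) \<or>
     (\<exists>S. finite S \<and> (\<forall>P\<in>S. primeideal P R) \<and> A = (\<Otimes>\<^bsub>ideals_set R\<^esub>P\<in>S. P))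
     \<longrightarrow> I_r (R Quot A) = davenport (units_of (R Quot A)) + Omega R A - omega R A)"
proof -
  interpret dedekind_domain R by fact
  interpret T: cring "R Quot A" by (rule ideal.quotient_is_cring[OF assms(2) is_cring])
  interpret U: comm_group "units_of (R Quot A)" by (rule T.units_comm_group)
  \<comment> \<open>The subtraction is regrouped, which on naturals requires omega \<le>
    Omega.\<close>
  have dav: "davenport (units_of (R Quot A)) + Omega R A - omega R A
      = I_r (units_of (R Quot A)) + (Omega R A - omega R A)"
    using omega_le_Omega[of R A] by (simp add: U.davenport_eq_I_r)
  show ?thesis
  proof (cases "A = {\<zero>\<^bsub>R\<^esub>}")
    \<comment> \<open>By convention the zero ideal is its own single factor, so Omega - omega is 0;
      it is prime, and the radical case yields equality and with it the inequality.\<close>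
    case True
    have "I_r (R Quot A) = I_r (units_of (R Quot A))"
      using zeroprimeideal assms(2,3) True by (intro I_r_Quot_radical[of _ "{{\<zero>\<^bsub>R\<^esub>}}"]) auto
    moreover have "Omega R A - omega R A = 0"
      unfolding True Omega_def omega_def by (simp add: prime_ideal_factorization_zero)
    ultimately show ?thesis unfolding dav by simp
  next
    case False
    obtain M where M: "prime_mset M" "A = ideal_mset_prod R M" using exists_prime_mset[OF assms(2) False] by blast
    have OO: "Omega R A - omega R A = size M - card (set_mset M)"
      using prime_ideal_factorization_eqI[OF M] by (simp add: Omega_def omega_def)
    show ?thesis
      unfolding dav OO
      using I_r_Quot_ge[OF M assms(3)] I_r_Quot_eq_maximal_pow[OF _ _ False assms(3) M]
        I_r_Quot_eq_squarefree[OF _ _ _ False assms(3) M] by blast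
  qed
qed

end
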